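(* Let $G$ be a graph on vertex set $\{1,\ldots,n\}$, let $A\in\mathcal{S}(G)$ have the strong spectral property, let $v\in V(G)$, and let $\lambda\in\mathbb{R}$ with $\lambda\notin\operatorname{spec}(A)\cup\operatorname{spec}(A(v))$. Then for every positive integer $s$ there exists a matrix $A'\in\mathcal{S}(G\oplus_v K_{s+1})$ having the strong spectral property such that $\operatorname{spec}(A')=\operatorname{spec}(A)\cup\{\lambda^{(s)}\}$. Moreover, $A'$ can be chosen arbitrarily close to $A\oplus\lambda I_s$ while the $(i,i)$-entry of $A'$ is different from $\lambda$ for every $i\in V(K_{s+1})\setminus\{v\}$.
   Context: For a graph $G$ on $\{1,\ldots,n\}$, $\mathcal{S}(G)$ is the set of $n\times n$ real symmetric matrices $A=(a_{ij})$ with, for $i\neq j$, $a_{ij}\neq0$ iff $\{i,j\}\in E(G)$. A real symmetric matrix $A$ has the strong spectral property if the only real symmetric $X$ with $A\circ X=O$, $I\circ X=O$ and $AX-XA=O$ is $X=O$ ($\circ$ entrywise product). $A(v)$ is the submatrix of $A$ obtained by deleting row and column $v$. $G\oplus_v K_{s+1}$ is the graph obtained from $G$ and a complete graph $K_{s+1}$ by identifying one vertex of $K_{s+1}$ with $v$; its remaining $s$ vertices are labelled $n+1,\ldots,n+s$. $\lambda^{(s)}$ denotes $s$ copies of $\lambda$, and unions of spectra are multiset unions. *)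

theory Defs
  imports "Jordan_Normal_Form.Char_Poly" "Jordan_Normal_Form.Determinant"
    "HOL-Computational_Algebra.Polynomial"
begin

definition graph_on :: "nat \<Rightarrow> nat set set \<Rightarrow> bool" where
  "graph_on n E \<longleftrightarrow>
     (\<forall>e\<in>E. \<exists>i j. e = {i, j} \<and> i \<noteq> j \<and> i \<in> {1..n} \<and> j \<in> {1..n})"

text \<open>Matrices are 0-indexed: the entry a_ij (vertices i j in {1..n}) is A $$ (i-1, j-1).\<close>
definition sym_mat :: "real mat \<Rightarrow> bool" where
  "sym_mat A \<longleftrightarrow> A \<in> carrier_mat (dim_row A) (dim_row A) \<and> transpose_mat A = A"

definition S_graph :: "nat \<Rightarrow> nat set set \<Rightarrow> real mat set" where
  "S_graph n E = {A. A \<in> carrier_mat n n \<and> transpose_mat A = A \<and>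
     (\<forall>i\<in>{1..n}. \<forall>j\<in>{1..n}. i \<noteq> j \<longrightarrow> (A $$ (i-1, j-1) \<noteq> 0 \<longleftrightarrow> {i, j} \<in> E))}"

definition hadamard :: "real mat \<Rightarrow> real mat \<Rightarrow> real mat" where
  "hadamard A B = mat (dim_row A) (dim_col A) (\<lambda>(i,j). A $$ (i,j) * B $$ (i,j))"

definition SSP :: "real mat \<Rightarrow> bool" where
  "SSP A \<longleftrightarrow> (\<forall>X \<in> carrier_mat (dim_row A) (dim_row A).
     transpose_mat X = X \<and> hadamard A X = 0\<^sub>m (dim_row A) (dim_row A)
     \<and> hadamard (1\<^sub>m (dim_row A)) X = 0\<^sub>m (dim_row A) (dim_row A)
     \<and> A * X - X * A = 0\<^sub>m (dim_row A) (dim_row A)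
     \<longrightarrow> X = 0\<^sub>m (dim_row A) (dim_row A))"

definition spec :: "real mat \<Rightarrow> real multiset" where
  "spec A = proots (char_poly A)"

definition del_vertex :: "real mat \<Rightarrow> nat \<Rightarrow> real mat" where
  "del_vertex A v = mat_delete A (v-1) (v-1)"

definition clique_sum :: "nat \<Rightarrow> nat set set \<Rightarrow> nat \<Rightarrow> nat \<Rightarrow> nat set set" where
  "clique_sum n E v s = E \<union>
     {{i, j} | i j. i \<noteq> j \<and> i \<in> insert v {n+1..n+s} \<and> j \<in> insert v {n+1..n+s}}"

definition direct_sum_scalar :: "real mat \<Rightarrow> real \<Rightarrow> nat \<Rightarrow> real mat" where
  "direct_sum_scalar A l s = four_block_mat A (0\<^sub>m (dim_row A) s) (0\<^sub>m s (dim_row A)) (l \<cdot>\<^sub>m 1\<^sub>m s)"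

end

theory Submission
  imports "HOL-Analysis.Function_Topology" Defs
begin

text \<open>Two steps. For \<open>s = 1\<close> one looks for an orthogonal conjugate \<open>N\<close> of \<open>M = A \<oplus> [l]\<close> near \<open>M\<close> whose entries at
  the non-edges of \<open>M\<close> vanish, except for a small \<open>t\<close> at \<open>(v, n + 1)\<close>. Among all orthogonal \<open>Q\<close> take a minimiser of
  \<open>\<parallel>R\<parallel> + e \<parallel>Q - I\<parallel>\<close>, where \<open>R\<close> is the deviation of \<open>N = Q\<^sup>T M Q\<close> from the prescribed entries. Comparison with \<open>Q = I\<close>
  keeps \<open>N\<close> close to \<open>M\<close>, and if \<open>R \<noteq> 0\<close>, stationarity along plane rotations bounds \<open>N R - R N\<close> by a small multiple of \<open>R\<close>,
  which the strong spectral property of \<open>M\<close> forbids; so \<open>R = 0\<close>. If the last diagonal entry of \<open>N\<close> were \<open>l\<close>,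
  then \<open>det (N - l I)\<close> would be \<open>- t\<^sup>2\<close> times a minor close to \<open>det (A(v) - l I)\<close>, although \<open>l\<close> is an eigenvalue of \<open>N\<close>.

  For general \<open>s\<close>, the last vertex of \<open>N\<close> is spread over \<open>s\<close> vertices: \<open>A' = l I + J\<^sup>T (N - l I) J\<close> with \<open>J J\<^sup>T = I\<close>.
  If \<open>X\<close> is a test matrix for \<open>A'\<close>, then \<open>J X J\<^sup>T\<close> is one for \<open>N\<close>, and the rest of \<open>X\<close> consists of
  eigenvectors for \<open>l\<close> of a matrix close to \<open>A\<close>.\<close>

section \<open>Compactness and lower bounds for the commutator\<close>

lemma index_mult_sum:
  assumes "A \<in> carrier_mat n k" "B \<in> carrier_mat k m" "i < n" "j < m"
  shows "(A * B) $$ (i, j) = (\<Sum>l<k. A $$ (i, l) * B $$ (l, j))"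
  using assms by (simp add: scalar_prod_def atLeast0LessThan)

lemma sym_entry:
  assumes "transpose_mat X = X" "X \<in> carrier_mat m m" "i < m" "j < m"
  shows "X $$ (j, i) = X $$ (i, j)"
  using assms by (metis carrier_matD index_transpose_mat(1))

text \<open>Matrices are represented by all functions \<open>q\<close> on index pairs, where the
  product topology applies; values of \<open>q\<close> outside the index square do not affect
  \<open>mat m m q\<close>. Bounded entries put a representative of every admissible matrix into a
  compact box (Tychonoff).\<close>

lemma mat_attains_inf:
  fixes P :: "real mat \<Rightarrow> bool" and f :: "real mat \<Rightarrow> real"
  assumes "closed {q. P (mat m m q)}"
    and bounded: "\<And>X i j. X \<in> carrier_mat m m \<Longrightarrow> P X \<Longrightarrow> i < m \<Longrightarrow> j < m \<Longrightarrow> \<bar>X $$ (i, j)\<bar> \<le> 1"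
    and "continuous_on UNIV (\<lambda>q. f (mat m m q))"
    and "X0 \<in> carrier_mat m m" "P X0"
  obtains X where "X \<in> carrier_mat m m" "P X" "\<And>Y. Y \<in> carrier_mat m m \<Longrightarrow> P Y \<Longrightarrow> f X \<le> f Y"
proof -
  define I where "I = {..<m} \<times> {..<m}"
  \<comment> \<open>The singleton factors \<open>{0}\<close> outside the index square keep the
    infinite product compact without losing any matrix.\<close>
  define box :: "(nat \<times> nat \<Rightarrow> real) set"
    where "box = PiE UNIV (\<lambda>p. if p \<in> I then {-1..1} else {0})"
  have "compactin (product_topology (\<lambda>p::nat \<times> nat. euclidean::real topology) UNIV) box"
    unfolding box_def compactin_PiE by (auto simp: compactin_euclidean_iff)
  then have "compact box"
    by (simp add: euclidean_product_topology compactin_euclidean_iff)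
  then have "compact (box \<inter> {q. P (mat m m q)})"
    using assms(1) by (rule compact_Int_closed)
  moreover have repr: "\<exists>q \<in> box. X = mat m m q" if "X \<in> carrier_mat m m" "P X" for X
  proof
    show "X = mat m m (\<lambda>p. if p \<in> I then X $$ p else 0)"
      using that(1) by (intro eq_matI) (auto simp: I_def)
    have "X $$ p \<in> {-1..1}" if "p \<in> I" for p
      using bounded[OF \<open>X \<in> carrier_mat m m\<close> \<open>P X\<close>, of "fst p" "snd p"] that
      by (auto simp: I_def abs_le_iff)
    then show "(\<lambda>p. if p \<in> I then X $$ p else 0) \<in> box"
      by (auto simp: box_def PiE_def)
  qed
  moreover have "box \<inter> {q. P (mat m m q)} \<noteq> {}"
    using repr[OF assms(4,5)] assms(5) by auto
  moreover have "continuous_on (box \<inter> {q. P (mat m m q)}) (\<lambda>q. f (mat m m q))"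
    using assms(3) by (rule continuous_on_subset) auto
  ultimately obtain q where q: "P (mat m m q)"
    and least: "\<And>r. r \<in> box \<Longrightarrow> P (mat m m r) \<Longrightarrow> f (mat m m q) \<le> f (mat m m r)"
    using continuous_attains_inf[of "box \<inter> {q. P (mat m m q)}" "\<lambda>q. f (mat m m q)"] by auto
  show ?thesis
  proof (rule that[of "mat m m q"])
    show "f (mat m m q) \<le> f Y" if "Y \<in> carrier_mat m m" "P Y" for Y
      using repr[OF that] least that(2) by auto
  qed (auto simp: q)
qed

section \<open>The entrywise 1-norm\<close>

definition l1 :: "real mat \<Rightarrow> real" where
  "l1 X = (\<Sum>i<dim_row X. \<Sum>j<dim_col X. \<bar>X $$ (i, j)\<bar>)"

lemma l1_carrier: "X \<in> carrier_mat m m \<Longrightarrow> l1 X = (\<Sum>i<m. \<Sum>j<m. \<bar>X $$ (i, j)\<bar>)"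
  by (simp add: l1_def)

lemma l1_nonneg: "l1 X \<ge> 0"
  by (simp add: l1_def sum_nonneg)

lemma entry_le_l1:
  assumes "X \<in> carrier_mat m m" "i < m" "j < m"
  shows "\<bar>X $$ (i, j)\<bar> \<le> l1 X"
proof -
  have "\<bar>X $$ (i, j)\<bar> \<le> (\<Sum>j<m. \<bar>X $$ (i, j)\<bar>)"
    by (rule member_le_sum) (use assms in auto)
  also have "\<dots> \<le> (\<Sum>i<m. \<Sum>j<m. \<bar>X $$ (i, j)\<bar>)"
    by (rule member_le_sum[of i "{..<m}" "\<lambda>i. \<Sum>j<m. \<bar>X $$ (i, j)\<bar>"]) (use assms in \<open>auto intro: sum_nonneg\<close>)
  finally show ?thesis using assms by (simp add: l1_carrier)
qed

lemma l1_eq_0: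
  assumes "X \<in> carrier_mat m m" "l1 X = 0"
  shows "X = 0\<^sub>m m m"
  using entry_le_l1[OF assms(1)] assms by (intro eq_matI) fastforce+

lemma l1_le:
  assumes "X \<in> carrier_mat m m" "\<And>i j. i < m \<Longrightarrow> j < m \<Longrightarrow> \<bar>X $$ (i, j)\<bar> \<le> c"
  shows "l1 X \<le> real m ^ 2 * c"
proof -
  have "l1 X \<le> (\<Sum>i<m. \<Sum>j<m. c)"
    unfolding l1_carrier[OF assms(1)] by (intro sum_mono) (use assms in auto)
  then show ?thesis by (simp add: power2_eq_square)
qed

lemma l1_smult: "l1 (c \<cdot>\<^sub>m X) = \<bar>c\<bar> * l1 X"
  by (simp add: l1_def abs_mult sum_distrib_left)

lemma l1_triangle_le:
  assumes "X \<in> carrier_mat m m" "Y \<in> carrier_mat m m"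
  shows "l1 X \<le> l1 Y + l1 (X - Y)"
proof -
  have "(\<Sum>i<m. \<Sum>j<m. \<bar>X $$ (i, j)\<bar>) \<le> (\<Sum>i<m. \<Sum>j<m. \<bar>Y $$ (i, j)\<bar> + \<bar>X $$ (i, j) - Y $$ (i, j)\<bar>)"
    by (intro sum_mono) auto
  then show ?thesis
    using assms by (simp add: l1_def sum.distrib)
qed

lemma l1_diff_le:
  assumes "X \<in> carrier_mat m m" "Y \<in> carrier_mat m m"
  shows "l1 (X - Y) \<le> l1 X + l1 Y"
proof -
  have "(\<Sum>i<m. \<Sum>j<m. \<bar>X $$ (i, j) - Y $$ (i, j)\<bar>) \<le> (\<Sum>i<m. \<Sum>j<m. \<bar>X $$ (i, j)\<bar> + \<bar>Y $$ (i, j)\<bar>)"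
    by (intro sum_mono) auto
  then show ?thesis
    using assms by (simp add: l1_def sum.distrib)
qed

text \<open>Each entry of \<open>Y\<close> occurs once for every value of the outer index carried by
  \<open>X\<close> alone, which gives the factor \<open>m\<close>.\<close>

lemma l1_mult_le:
  assumes "X \<in> carrier_mat m m" "Y \<in> carrier_mat m m"
    and small: "\<And>i j. i < m \<Longrightarrow> j < m \<Longrightarrow> \<bar>X $$ (i, j)\<bar> \<le> c"
  shows "l1 (X * Y) \<le> real m * c * l1 Y" "l1 (Y * X) \<le> real m * c * l1 Y"
proof -
  have "l1 (X * Y) \<le> (\<Sum>i<m. \<Sum>j<m. \<Sum>k<m. c * \<bar>Y $$ (k, j)\<bar>)"
    unfolding l1_carrier[OF mult_carrier_mat[OF assms(1,2)]]
  proof (intro sum_mono)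
    fix i j assume "i \<in> {..<m}" "j \<in> {..<m}"
    then show "\<bar>(X * Y) $$ (i, j)\<bar> \<le> (\<Sum>k<m. c * \<bar>Y $$ (k, j)\<bar>)"
      by (subst index_mult_sum[OF assms(1,2)], simp, simp, intro sum_abs[THEN order_trans] sum_mono)
        (auto simp: abs_mult intro!: mult_right_mono small)
  qed
  also have "\<dots> = (\<Sum>i<m. \<Sum>k<m. \<Sum>j<m. c * \<bar>Y $$ (k, j)\<bar>)"
    by (intro sum.cong refl sum.swap)
  also have "\<dots> = real m * c * l1 Y"
    by (simp add: l1_carrier[OF assms(2)] sum_distrib_left mult.assoc)
  finally show "l1 (X * Y) \<le> real m * c * l1 Y" .
  have "l1 (Y * X) \<le> (\<Sum>i<m. \<Sum>j<m. \<Sum>k<m. c * \<bar>Y $$ (i, k)\<bar>)"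
    unfolding l1_carrier[OF mult_carrier_mat[OF assms(2,1)]]
  proof (intro sum_mono)
    fix i j assume "i \<in> {..<m}" "j \<in> {..<m}"
    then show "\<bar>(Y * X) $$ (i, j)\<bar> \<le> (\<Sum>k<m. c * \<bar>Y $$ (i, k)\<bar>)"
      by (subst index_mult_sum[OF assms(2,1)], simp, simp, intro sum_abs[THEN order_trans] sum_mono)
        (auto simp: abs_mult mult.commute[of c] intro!: mult_left_mono small)
  qed
  also have "\<dots> = real m * c * l1 Y"
    by (simp add: l1_carrier[OF assms(2)] sum_distrib_left mult.assoc)
  finally show "l1 (Y * X) \<le> real m * c * l1 Y" .
qed

section \<open>Commutators with symmetric matrices of prescribed support\<close>

definition commutator :: "real mat \<Rightarrow> real mat \<Rightarrow> real mat" where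
  "commutator N X = N * X - X * N"

lemma commutator_carrier [simp]:
  "N \<in> carrier_mat m m \<Longrightarrow> X \<in> carrier_mat m m \<Longrightarrow> commutator N X \<in> carrier_mat m m"
  unfolding commutator_def by auto

lemma index_commutator:
  assumes "N \<in> carrier_mat m m" "X \<in> carrier_mat m m" "i < m" "j < m"
  shows "commutator N X $$ (i, j) = (\<Sum>k<m. N $$ (i, k) * X $$ (k, j)) - (\<Sum>k<m. X $$ (i, k) * N $$ (k, j))"
  using assms by (simp add: commutator_def index_mult_sum[of _ m m _ m] del: index_mult_mat(1))

lemma commutator_smult:
  assumes "N \<in> carrier_mat m m" "X \<in> carrier_mat m m"
  shows "commutator N (c \<cdot>\<^sub>m X) = c \<cdot>\<^sub>m commutator N X"
  using assms unfolding commutator_def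
  by (intro eq_matI) (auto simp: right_diff_distrib)

lemma continuous_on_l1_mat:
  assumes "\<And>q. F (mat m m q) \<in> carrier_mat m m"
    and "\<And>i j. i < m \<Longrightarrow> j < m \<Longrightarrow> continuous_on UNIV (\<lambda>q. F (mat m m q) $$ (i, j))"
  shows "continuous_on UNIV (\<lambda>q. l1 (F (mat m m q)))"
  unfolding l1_carrier[OF assms(1)] by (intro continuous_intros assms(2)) auto

text \<open>\<open>W\<close> marks the positions where entries may be nonzero. With the non-edges of
  a matrix for \<open>W\<close>, these are the test matrices of its strong spectral
  property.\<close>

definition supported :: "nat \<Rightarrow> (nat \<Rightarrow> nat \<Rightarrow> bool) \<Rightarrow> real mat \<Rightarrow> bool" where
  "supported m W X \<longleftrightarrow> X \<in> carrier_mat m m \<and> transpose_mat X = X \<and>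
     (\<forall>i<m. \<forall>j<m. \<not> W i j \<longrightarrow> X $$ (i, j) = 0)"

lemma sym_iff: "X \<in> carrier_mat m m \<Longrightarrow> transpose_mat X = X \<longleftrightarrow> (\<forall>i<m. \<forall>j<m. X $$ (i, j) = X $$ (j, i))"
  by (auto simp: mat_eq_iff)

text \<open>On the space of supported matrices the commutator with \<open>M\<close> is linear and
  injective, so its norm has a positive minimum on the compact unit sphere; homogeneity extends the
  bound to all \<open>X\<close>.\<close>

lemma commutator_bounded_below:
  assumes M: "M \<in> carrier_mat m m"
    and inj: "\<And>X. supported m W X \<Longrightarrow> commutator M X = 0\<^sub>m m m \<Longrightarrow> X = 0\<^sub>m m m"
  shows "\<exists>\<mu>>0. \<forall>X. supported m W X \<longrightarrow> \<mu> * l1 X \<le> l1 (commutator M X)"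
proof (cases "\<exists>X. supported m W X \<and> l1 X = 1")
  case True
  then obtain X0 where X0: "supported m W X0" "l1 X0 = 1" by blast
  have pos: "0 < l1 (commutator M X)" if "supported m W X" "l1 X \<noteq> 0" for X
  proof -
    have "X \<in> carrier_mat m m" using that by (simp add: supported_def)
    moreover have "X \<noteq> 0\<^sub>m m m" using that(2) by (auto simp: l1_def)
    ultimately have "l1 (commutator M X) \<noteq> 0"
      using inj[OF that(1)] l1_eq_0 commutator_carrier[OF M] by blast
    then show ?thesis using l1_nonneg[of "commutator M X"] by simp
  qed
  obtain X where X: "supported m W X" "l1 X = 1"
    and least: "\<And>Y. Y \<in> carrier_mat m m \<Longrightarrow> supported m W Y \<and> l1 Y = 1 \<Longrightarrow>
      l1 (commutator M X) \<le> l1 (commutator M Y)"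
  proof (rule mat_attains_inf[of "\<lambda>X. supported m W X \<and> l1 X = 1" m "\<lambda>X. l1 (commutator M X)" X0])
    have "{q. supported m W (mat m m q) \<and> l1 (mat m m q) = 1} =
      {q. (\<forall>i j. i < m \<longrightarrow> j < m \<longrightarrow> q (i, j) = q (j, i)) \<and>
        (\<forall>i j. i < m \<longrightarrow> j < m \<longrightarrow> \<not> W i j \<longrightarrow> q (i, j) = 0) \<and> (\<Sum>i<m. \<Sum>j<m. \<bar>q (i, j)\<bar>) = 1}"
      by (auto simp: supported_def sym_iff[of _ m] l1_def)
    also have "closed \<dots>"
      by (intro closed_Collect_conj closed_Collect_all closed_Collect_imp closed_Collect_eq open_Collect_const
          continuous_intros continuous_on_product_coordinates)
    finally show "closed {q. supported m W (mat m m q) \<and> l1 (mat m m q) = 1}" .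
    show "continuous_on UNIV (\<lambda>q. l1 (commutator M (mat m m q)))"
      by (rule continuous_on_l1_mat)
        (auto simp: M index_commutator[of M m] intro!: continuous_intros)
    show "\<bar>X $$ (i, j)\<bar> \<le> 1" if "X \<in> carrier_mat m m" "supported m W X \<and> l1 X = 1" "i < m" "j < m" for X i j
      using entry_le_l1[OF that(1,3,4)] that by simp
  qed (use X0 in \<open>auto simp: supported_def\<close>)
  show ?thesis
  proof (intro exI[of _ "l1 (commutator M X)"] conjI allI impI)
    show "0 < l1 (commutator M X)" using pos X by simp
    fix Y assume Y: "supported m W Y"
    then have carr: "Y \<in> carrier_mat m m" by (simp add: supported_def)
    show "l1 (commutator M X) * l1 Y \<le> l1 (commutator M Y)"
    proof (cases "l1 Y = 0")
      case True
      then show ?thesis by (simp add: l1_nonneg)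
    next
      case False
      then have "l1 Y > 0" using l1_nonneg[of Y] by simp
      define c where "c = 1 / l1 Y"
      have "supported m W (c \<cdot>\<^sub>m Y)"
        using Y carr by (auto simp: supported_def sym_iff[of _ m])
      moreover have "l1 (c \<cdot>\<^sub>m Y) = 1" using \<open>l1 Y > 0\<close> by (simp add: l1_smult c_def)
      ultimately have "l1 (commutator M X) \<le> l1 (commutator M (c \<cdot>\<^sub>m Y))"
        using least carr by simp
      also have "commutator M (c \<cdot>\<^sub>m Y) = c \<cdot>\<^sub>m commutator M Y"
        using M carr by (rule commutator_smult)
      finally show ?thesis
        using \<open>l1 Y > 0\<close> by (simp add: l1_smult c_def field_simps)
    qed
  qed
next
  \<comment> \<open>The unit sphere is empty, so every supported matrix is zero and any positive
    constant will do.\<close>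
  case False
  have "l1 X = 0" if "supported m W X" for X
  proof (rule ccontr)
    assume "l1 X \<noteq> 0"
    moreover have "supported m W ((1 / l1 X) \<cdot>\<^sub>m X)"
      using that by (auto simp: supported_def sym_iff[of _ m])
    moreover have "l1 ((1 / l1 X) \<cdot>\<^sub>m X) = 1"
      using \<open>l1 X \<noteq> 0\<close> l1_nonneg[of X] by (simp add: l1_smult)
    ultimately show False using False by blast
  qed
  then show ?thesis by (intro exI[of _ 1]) (auto simp: l1_nonneg)
qed

text \<open>Replacing \<open>M\<close> by \<open>N\<close> changes the commutator by
  \<open>D * X - X * D\<close> with \<open>D = M - N\<close>, of norm at most
  \<open>2 * m * \<sigma> * l1 X\<close>. One number serves both as radius and as lower
  bound.\<close>

lemma commutator_bounded_below_near:
  assumes M: "M \<in> carrier_mat m m"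
    and inj: "\<And>X. supported m W X \<Longrightarrow> commutator M X = 0\<^sub>m m m \<Longrightarrow> X = 0\<^sub>m m m"
  obtains \<sigma> where "\<sigma> > 0"
    "\<And>N X. N \<in> carrier_mat m m \<Longrightarrow> (\<And>i j. i < m \<Longrightarrow> j < m \<Longrightarrow> \<bar>N $$ (i, j) - M $$ (i, j)\<bar> \<le> \<sigma>) \<Longrightarrow>
      supported m W X \<Longrightarrow> \<sigma> * l1 X \<le> l1 (commutator N X)"
proof -
  obtain \<mu> where "\<mu> > 0" and \<mu>: "\<And>X. supported m W X \<Longrightarrow> \<mu> * l1 X \<le> l1 (commutator M X)"
    using commutator_bounded_below[OF assms] by blast
  \<comment> \<open>Solves \<open>\<sigma> + 2 * m * \<sigma> = \<mu>\<close>: once the perturbation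
    has used up \<open>2 * m * \<sigma>\<close>, exactly \<open>\<sigma>\<close> remains.\<close>
  define \<sigma> where "\<sigma> = \<mu> / (2 * real m + 1)"
  have \<sigma>: "\<sigma> + 2 * real m * \<sigma> = \<mu>"
  proof -
    have "\<sigma> * (2 * real m + 1) = \<mu>" by (simp add: \<sigma>_def add_nonneg_eq_0_iff)
    then show ?thesis by (simp add: algebra_simps)
  qed
  show ?thesis
  proof (rule that)
    show "\<sigma> > 0" using \<open>\<mu> > 0\<close> by (simp add: \<sigma>_def)
    fix N X assume N: "N \<in> carrier_mat m m" and X: "supported m W X"
      and near: "\<And>i j. i < m \<Longrightarrow> j < m \<Longrightarrow> \<bar>N $$ (i, j) - M $$ (i, j)\<bar> \<le> \<sigma>"
    have carr: "X \<in> carrier_mat m m" using X by (simp add: supported_def)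
    define D where "D = M - N"
    have D: "D \<in> carrier_mat m m" unfolding D_def using N by (rule minus_carrier_mat)
    have small: "\<bar>D $$ (i, j)\<bar> \<le> \<sigma>" if "i < m" "j < m" for i j
      using near[OF that] M N that by (simp add: D_def abs_minus_commute)
    have "D * X = M * X - N * X" "X * D = X * M - X * N"
      unfolding D_def by (rule minus_mult_distrib_mat[OF M N carr] mult_minus_distrib_mat[OF carr M N])+
    then have "commutator M X - commutator N X = D * X - X * D"
      using M N carr unfolding commutator_def
      by (intro eq_matI) (simp_all del: index_mult_mat(1))
    then have "l1 (commutator M X - commutator N X) = l1 (D * X - X * D)" by simp
    moreover have "l1 (D * X - X * D) \<le> l1 (D * X) + l1 (X * D)"
      using D carr by (intro l1_diff_le) auto
    moreover have "l1 (D * X) \<le> real m * \<sigma> * l1 X" "l1 (X * D) \<le> real m * \<sigma> * l1 X"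
      using l1_mult_le[OF D carr small] by auto
    moreover have "l1 (commutator M X) \<le> l1 (commutator N X) + l1 (commutator M X - commutator N X)"
      by (rule l1_triangle_le[OF commutator_carrier[OF M carr] commutator_carrier[OF N carr]])
    moreover have "\<mu> * l1 X = \<sigma> * l1 X + 2 * (real m * \<sigma> * l1 X)"
      unfolding \<sigma>[symmetric] by (simp add: algebra_simps)
    ultimately show "\<sigma> * l1 X \<le> l1 (commutator N X)"
      using \<mu>[OF X] by linarith
  qed
qed

section \<open>Isospectral matrices with prescribed entries\<close>

definition plane_rot :: "nat \<Rightarrow> nat \<Rightarrow> real \<Rightarrow> nat \<Rightarrow> (nat \<Rightarrow> real) \<Rightarrow> real" where
  "plane_rot p q \<theta> i x =
     (if i = p then cos \<theta> * x p - sin \<theta> * x q else if i = q then sin \<theta> * x p + cos \<theta> * x q else x i)"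

definition plane_rot_deriv :: "nat \<Rightarrow> nat \<Rightarrow> nat \<Rightarrow> (nat \<Rightarrow> real) \<Rightarrow> real" where
  "plane_rot_deriv p q i x = (if i = p then - x q else if i = q then x p else 0)"

text \<open>Row \<open>k\<close> holds the coordinates of the rotated \<open>k\<close>-th unit
  vector. Right multiplication thus rotates every row, and left multiplication by the transpose
  every column, both by the formula \<open>plane_rot\<close>.\<close>

definition givens :: "nat \<Rightarrow> nat \<Rightarrow> nat \<Rightarrow> real \<Rightarrow> real mat" where
  "givens m p q \<theta> = mat m m (\<lambda>(k, i). plane_rot p q \<theta> i (\<lambda>j. if j = k then 1 else 0))"

lemma givens_carrier [simp]: "givens m p q \<theta> \<in> carrier_mat m m"
  by (simp add: givens_def)

lemma plane_rot_0 [simp]: "plane_rot p q 0 i x = x i"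
  by (simp add: plane_rot_def)

lemma has_derivative_plane_rot:
  assumes "\<And>k. ((\<lambda>\<theta>. x \<theta> k) has_real_derivative x' k) (at 0)"
  shows "((\<lambda>\<theta>. plane_rot p q \<theta> i (x \<theta>)) has_real_derivative
    plane_rot_deriv p q i (x 0) + x' i) (at 0)"
  unfolding plane_rot_def plane_rot_deriv_def
  by (cases "i = p"; cases "i = q") (auto intro!: derivative_eq_intros assms)

text \<open>Linear in \<theta> because \<open>|sin \<theta>| \<le> |\<theta>|\<close> and
  \<open>1 - cos \<theta> = 2 * (sin (\<theta> / 2))^2\<close>. The estimate limits how fast the
  penalty on the distance from \<open>Q\<close> to the identity can grow along a rotation.\<close>

lemma plane_rot_diff_le:
  assumes "\<And>k. \<bar>x k\<bar> \<le> 1"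
  shows "\<bar>plane_rot p q \<theta> i x - x i\<bar> \<le> 2 * \<bar>\<theta>\<bar>"
proof -
  have s: "\<bar>sin \<theta> * x k\<bar> \<le> \<bar>\<theta>\<bar>" for k
    using mult_mono[OF abs_sin_x_le_abs_x[of \<theta>] assms[of k]] by (simp add: abs_mult)
  have "\<bar>cos \<theta> - 1\<bar> = 2 * (\<bar>sin (\<theta> / 2)\<bar> * \<bar>sin (\<theta> / 2)\<bar>)"
    using cos_double_sin[of "\<theta> / 2"] by (simp add: power2_eq_square flip: abs_mult)
  also have "\<dots> \<le> 2 * (\<bar>\<theta> / 2\<bar> * 1)"
    by (intro mult_left_mono mult_mono abs_sin_x_le_abs_x) auto
  finally have "\<bar>(cos \<theta> - 1) * x k\<bar> \<le> \<bar>\<theta>\<bar>" for k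
    using mult_mono[of "\<bar>cos \<theta> - 1\<bar>" "\<bar>\<theta>\<bar>" "\<bar>x k\<bar>" 1] assms[of k] by (simp add: abs_mult)
  from this[of p] this[of q] s[of p] s[of q] show ?thesis
    unfolding plane_rot_def left_diff_distrib abs_le_iff by auto
qed

lemma sum_givens:
  assumes "p < m" "q < m" "i < m"
  shows "(\<Sum>k<m. x k * givens m p q \<theta> $$ (k, i)) = plane_rot p q \<theta> i x"
proof -
  have "(\<Sum>k<m. x k * givens m p q \<theta> $$ (k, i)) =
    plane_rot p q \<theta> i (\<lambda>j. \<Sum>k<m. x k * (if j = k then 1 else 0))"
    using assms by (simp add: givens_def plane_rot_def sum_distrib_left sum_subtractf sum.distrib algebra_simps)
  also have "\<dots> = plane_rot p q \<theta> i x"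
  proof -
    have "(\<Sum>k<m. x k * (if j = k then 1 else 0)) = x j" if "j < m" for j
      using that by (simp add: if_distrib cong: if_cong)
    then show ?thesis using assms by (simp add: plane_rot_def)
  qed
  finally show ?thesis .
qed

lemma index_mult_givens:
  assumes "X \<in> carrier_mat m m" "p < m" "q < m" "i < m" "j < m"
  shows "(X * givens m p q \<theta>) $$ (i, j) = plane_rot p q \<theta> j (\<lambda>k. X $$ (i, k))"
  using assms by (simp add: index_mult_sum[of _ m m _ m] sum_givens del: index_mult_mat(1))

lemma index_transpose_givens_mult:
  assumes "X \<in> carrier_mat m m" "p < m" "q < m" "i < m" "j < m"
  shows "(transpose_mat (givens m p q \<theta>) * X) $$ (i, j) = plane_rot p q \<theta> i (\<lambda>k. X $$ (k, j))"
proof -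
  have "(\<Sum>k<m. transpose_mat (givens m p q \<theta>) $$ (i, k) * X $$ (k, j)) =
    (\<Sum>k<m. X $$ (k, j) * givens m p q \<theta> $$ (k, i))"
    using assms by (intro sum.cong) (auto simp: givens_def)
  then show ?thesis
    using assms by (simp add: index_mult_sum[of _ m m _ m] sum_givens del: index_mult_mat(1))
qed

lemma givens_orthogonal:
  assumes "p < m" "q < m" "p \<noteq> q"
  shows "transpose_mat (givens m p q \<theta>) * givens m p q \<theta> = 1\<^sub>m m"
proof (rule eq_matI)
  fix i j assume "i < dim_row (1\<^sub>m m)" "j < dim_col (1\<^sub>m m)"
  then have "i < m" "j < m" by auto
  then have "(transpose_mat (givens m p q \<theta>) * givens m p q \<theta>) $$ (i, j) =
    plane_rot p q \<theta> i (\<lambda>k. plane_rot p q \<theta> j (\<lambda>l. if l = k then 1 else 0))"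
    using assms by (subst index_transpose_givens_mult) (auto simp: givens_def plane_rot_def)
  also have "\<dots> = 1\<^sub>m m $$ (i, j)"
    using \<open>i < m\<close> \<open>j < m\<close> assms(3) by (auto simp: plane_rot_def power2_eq_square[symmetric])
  finally show "(transpose_mat (givens m p q \<theta>) * givens m p q \<theta>) $$ (i, j) = 1\<^sub>m m $$ (i, j)" .
qed (auto simp: givens_def)

text \<open>The penalty may have a kink at the minimiser, so minimality gives only a cone below the
  graph of the smooth part, not a vanishing derivative. A slope steeper than \<open>c\<close> would
  take \<open>f\<close> below the cone on one side of 0.\<close>

lemma DERIV_bound_of_ge_cone:
  fixes f :: "real \<Rightarrow> real"
  assumes D: "(f has_real_derivative D) (at 0)" and ge: "\<And>\<theta>. f 0 - c * \<bar>\<theta>\<bar> \<le> f \<theta>"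
  shows "\<bar>D\<bar> \<le> c"
proof -
  have "\<not> c < D"
  proof
    assume "c < D"
    have "((\<lambda>\<theta>. f \<theta> - c * \<theta>) has_real_derivative D - c) (at 0)"
      by (auto intro!: derivative_eq_intros D)
    from DERIV_pos_inc_left[OF this] \<open>c < D\<close> obtain d where "d > 0"
      and "\<And>h. h > 0 \<Longrightarrow> h < d \<Longrightarrow> f (- h) - c * (- h) < f 0" by auto
    from this(2)[of "d / 2"] ge[of "- (d / 2)"] \<open>d > 0\<close> show False by simp
  qed
  moreover have "\<not> D < - c"
  proof
    assume "D < - c"
    have "((\<lambda>\<theta>. f \<theta> + c * \<theta>) has_real_derivative D + c) (at 0)"
      by (auto intro!: derivative_eq_intros D)
    from DERIV_neg_dec_right[OF this] \<open>D < - c\<close> obtain d where "d > 0"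
      and "\<And>h. h > 0 \<Longrightarrow> h < d \<Longrightarrow> f h + c * h < f 0" by auto
    from this(2)[of "d / 2"] ge[of "d / 2"] \<open>d > 0\<close> show False by simp
  qed
  ultimately show ?thesis by simp
qed

section \<open>Orthogonal conjugates and their residuals\<close>

lemma orthogonal_entry_le:
  fixes Q :: "real mat"
  assumes "Q \<in> carrier_mat m m" "transpose_mat Q * Q = 1\<^sub>m m" "i < m" "j < m"
  shows "\<bar>Q $$ (i, j)\<bar> \<le> 1"
proof -
  have "(Q $$ (i, j))\<^sup>2 \<le> (\<Sum>k<m. (Q $$ (k, j))\<^sup>2)"
    by (rule member_le_sum[of i "{..<m}" "\<lambda>k. (Q $$ (k, j))\<^sup>2"]) (use assms in auto)
  also have "\<dots> = (transpose_mat Q * Q) $$ (j, j)"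
    using assms(1,3,4) by (simp add: index_mult_sum[of _ m m _ m] power2_eq_square del: index_mult_mat(1))
  also have "\<dots> = 1" using assms by simp
  finally show ?thesis by (simp add: abs_square_le_1)
qed

text \<open>The Frobenius norm is taken with its square root: differentiating the root divides by
  the norm, which makes the stationarity bound on the commutator proportional to the
  residual.\<close>

definition frob :: "real mat \<Rightarrow> real" where
  "frob X = sqrt (\<Sum>i<dim_row X. \<Sum>j<dim_col X. (X $$ (i, j))\<^sup>2)"

lemma frob_carrier: "X \<in> carrier_mat m m \<Longrightarrow> frob X = sqrt (\<Sum>i<m. \<Sum>j<m. (X $$ (i, j))\<^sup>2)"
  by (simp add: frob_def)

lemma frob_nonneg: "0 \<le> frob X"
  by (simp add: frob_def sum_nonneg)

lemma frob_le_l1: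
  assumes "X \<in> carrier_mat m m"
  shows "frob X \<le> real m * l1 X"
proof -
  have "(\<Sum>i<m. \<Sum>j<m. (X $$ (i, j))\<^sup>2) \<le> (\<Sum>i<m. \<Sum>j<m. (l1 X)\<^sup>2)"
    by (intro sum_mono abs_le_square_iff[THEN iffD1]) (simp add: entry_le_l1[OF assms] l1_nonneg)
  also have "\<dots> = (real m * l1 X)\<^sup>2" by (simp add: power2_eq_square)
  finally show ?thesis
    unfolding frob_carrier[OF assms] by (rule real_le_lsqrt[rotated]) (simp add: l1_nonneg)
qed

text \<open>Zero off \<open>W\<close>, so that the deviation is itself a supported matrix, to which
  the lower bound for the commutator applies.\<close>

definition residual :: "nat \<Rightarrow> (nat \<Rightarrow> nat \<Rightarrow> bool) \<Rightarrow> real mat \<Rightarrow> real mat \<Rightarrow> real mat" where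
  "residual m W T N = mat m m (\<lambda>(i, j). if W i j then N $$ (i, j) - T $$ (i, j) else 0)"

lemma residual_carrier [simp]: "residual m W T N \<in> carrier_mat m m"
  by (simp add: residual_def)

lemma supported_residual:
  assumes "N \<in> carrier_mat m m" "transpose_mat N = N" "T \<in> carrier_mat m m" "transpose_mat T = T"
    and "\<And>i j. W i j \<Longrightarrow> W j i"
  shows "supported m W (residual m W T N)"
proof -
  have "residual m W T N $$ (i, j) = residual m W T N $$ (j, i)" if "i < m" "j < m" for i j
    using assms(5)[of i j] assms(5)[of j i] that sym_entry[OF assms(2,1) that] sym_entry[OF assms(4,3) that]
    by (auto simp: residual_def)
  then show ?thesis
    unfolding supported_def sym_iff[OF residual_carrier] by (auto simp: residual_def)
qed

lemma conj_carrier [simp]: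
  "M \<in> carrier_mat m m \<Longrightarrow> Q \<in> carrier_mat m m \<Longrightarrow> transpose_mat Q * M * Q \<in> carrier_mat m m"
  by (intro mult_carrier_mat[of _ m m]) auto

lemma transpose_conj:
  fixes M :: "real mat"
  assumes "M \<in> carrier_mat m m" "Q \<in> carrier_mat m m" "transpose_mat M = M"
  shows "transpose_mat (transpose_mat Q * M * Q) = transpose_mat Q * M * Q"
  using assms by (simp add: transpose_mult[of _ m m _ m] mult_carrier_mat[of _ m m] assoc_mult_mat[of _ m m _ m _ m])

lemma conj_mult:
  fixes M :: "real mat"
  assumes "M \<in> carrier_mat m m" "Q \<in> carrier_mat m m" "G \<in> carrier_mat m m"
  shows "transpose_mat (Q * G) * M * (Q * G) = transpose_mat G * (transpose_mat Q * M * Q) * G"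
proof -
  have "transpose_mat Q \<in> carrier_mat m m" "transpose_mat G \<in> carrier_mat m m" using assms by auto
  then show ?thesis
    using assms by (simp add: transpose_mult[of _ m m _ m] mult_carrier_mat[of _ m m] assoc_mult_mat[of _ m m _ m _ m])
qed

lemma char_poly_orthogonal_conj:
  fixes M :: "real mat"
  assumes "M \<in> carrier_mat m m" "Q \<in> carrier_mat m m" "transpose_mat Q * Q = 1\<^sub>m m"
  shows "char_poly (transpose_mat Q * M * Q) = char_poly M"
proof (rule char_poly_similar)
  have "Q * transpose_mat Q = 1\<^sub>m m"
    using assms by (intro mat_mult_left_right_inverse[of "transpose_mat Q" m Q]) auto
  then show "similar_mat (transpose_mat Q * M * Q) M"
    unfolding similar_mat_def
    using assms by (intro exI[of _ "transpose_mat Q"] exI[of _ Q] similar_mat_witI[of _ _ m]) auto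
qed

text \<open>A minimiser of the perturbed objective has almost vanishing derivative along every plane
  rotation; that derivative is an entry of the commutator of the matrix with its residual.\<close>

lemma commutator_residual_le:
  assumes M: "M \<in> carrier_mat m m" "transpose_mat M = M"
    and T: "T \<in> carrier_mat m m" "transpose_mat T = T"
    and W: "\<And>i j. W i j \<Longrightarrow> W j i"
    and Q: "Q \<in> carrier_mat m m" "transpose_mat Q * Q = 1\<^sub>m m"
    and "e \<ge> 0"
    and least: "\<And>Y. Y \<in> carrier_mat m m \<Longrightarrow> transpose_mat Y * Y = 1\<^sub>m m \<Longrightarrow>
      frob (residual m W T (transpose_mat Q * M * Q)) + e * l1 (Q - 1\<^sub>m m)
      \<le> frob (residual m W T (transpose_mat Y * M * Y)) + e * l1 (Y - 1\<^sub>m m)"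
    and nz: "frob (residual m W T (transpose_mat Q * M * Q)) \<noteq> 0"
    and pq: "p < m" "q < m" "p \<noteq> q"
  defines "N \<equiv> transpose_mat Q * M * Q"
  shows "\<bar>commutator N (residual m W T N) $$ (p, q)\<bar> \<le> real m ^ 2 * e * frob (residual m W T N)"
proof -
  define R where "R = residual m W T N"
  define G where "G \<theta> = givens m p q \<theta>" for \<theta>
  have G: "G \<theta> \<in> carrier_mat m m" "transpose_mat (G \<theta>) * G \<theta> = 1\<^sub>m m" for \<theta>
    using givens_orthogonal[OF pq] by (auto simp: G_def)
  have N: "N \<in> carrier_mat m m" "transpose_mat N = N"
    using M Q transpose_conj by (auto simp: N_def)
  have R: "R \<in> carrier_mat m m" "transpose_mat R = R"
    using supported_residual[OF N T W] by (auto simp: R_def supported_def)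
  define n where "n i j \<theta> = plane_rot p q \<theta> j (\<lambda>k. plane_rot p q \<theta> i (\<lambda>l. N $$ (l, k)))" for i j \<theta>
  have n: "(transpose_mat (G \<theta>) * N * G \<theta>) $$ (i, j) = n i j \<theta>" if "i < m" "j < m" for i j \<theta>
  proof -
    have "transpose_mat (G \<theta>) * N \<in> carrier_mat m m"
      using N G by (intro mult_carrier_mat[of _ m m]) auto
    then show ?thesis
      using that pq N(1) unfolding n_def G_def
      by (subst index_mult_givens) (auto simp: plane_rot_def index_transpose_givens_mult simp del: index_mult_mat(1))
  qed
  define f where "f \<theta> = frob (residual m W T (transpose_mat (G \<theta>) * N * G \<theta>))" for \<theta>
  define \<phi> where "\<phi> \<theta> = (\<Sum>i<m. \<Sum>j<m. (if W i j then n i j \<theta> - T $$ (i, j) else 0)\<^sup>2)" for \<theta>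
  have f: "f \<theta> = sqrt (\<phi> \<theta>)" for \<theta>
    unfolding f_def \<phi>_def frob_carrier[OF residual_carrier]
    by (intro arg_cong[where f = sqrt] sum.cong refl) (auto simp: residual_def n simp del: index_mult_mat(1))
  have n0: "n i j 0 = N $$ (i, j)" for i j by (simp add: n_def)
  have f0: "f 0 = frob R"
    unfolding f R_def \<phi>_def frob_carrier[OF residual_carrier] n0
    by (intro arg_cong[where f = sqrt] sum.cong refl) (auto simp: residual_def)
  \<comment> \<open>The residual is nonzero, so the square root is differentiable at this
    point.\<close>
  have "\<phi> 0 > 0"
  proof -
    have "sqrt (\<phi> 0) > 0" using nz f0 f[of 0] frob_nonneg[of R] by (simp add: R_def N_def)
    then show ?thesis by simp
  qed
  define n' where "n' i j = plane_rot_deriv p q j (\<lambda>k. N $$ (i, k)) + plane_rot_deriv p q i (\<lambda>l. N $$ (l, j))" for i j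
  have n': "(n i j has_real_derivative n' i j) (at 0)" for i j
    using has_derivative_plane_rot[of "\<lambda>\<theta> k. plane_rot p q \<theta> i (\<lambda>l. N $$ (l, k))"
        "\<lambda>k. plane_rot_deriv p q i (\<lambda>l. N $$ (l, k))" p q j]
      has_derivative_plane_rot[of "\<lambda>\<theta> l. N $$ (l, _)" "\<lambda>_. 0" p q i]
    unfolding n_def n'_def by simp
  define C where "C = commutator N R $$ (p, q)"
  have sum_deriv: "(\<Sum>i<m. x i * plane_rot_deriv p q i y) = x q * y p - x p * y q" for x y
  proof -
    have "(\<Sum>i<m. x i * plane_rot_deriv p q i y) =
      (\<Sum>i<m. (if i = q then x q * y p else 0) - (if i = p then x p * y q else 0))"
      using pq by (intro sum.cong) (auto simp: plane_rot_deriv_def)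
    then show ?thesis using pq by (simp add: sum_subtractf)
  qed
  have C: "(\<Sum>j<m. R $$ (q, j) * N $$ (p, j) - R $$ (p, j) * N $$ (q, j)) = C"
    unfolding C_def index_commutator[OF N(1) R(1) pq(1,2)] sum_subtractf[symmetric]
    by (intro sum.cong refl)
      (simp add: sym_entry[OF N(2,1) pq(2)] sym_entry[OF R(2,1) pq(2)] mult.commute)
  \<comment> \<open>The derivative at 0 is twice the inner product of \<open>R\<close> with the
    derivative of the rotated \<open>N\<close>. The row part and the column part of the latter
    contribute \<open>C\<close> each, by symmetry of \<open>N\<close> and \<open>R\<close>.\<close>
  have "(\<phi> has_real_derivative (\<Sum>i<m. \<Sum>j<m. 2 * R $$ (i, j) * n' i j)) (at 0)"
    unfolding \<phi>_def
  proof (intro DERIV_sum)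
    fix i j assume "i \<in> {..<m}" "j \<in> {..<m}"
    then show "((\<lambda>\<theta>. (if W i j then n i j \<theta> - T $$ (i, j) else 0)\<^sup>2) has_real_derivative 2 * R $$ (i, j) * n' i j) (at 0)"
      by (auto simp: R_def residual_def n0 intro!: derivative_eq_intros n')
  qed
  also have "(\<Sum>i<m. \<Sum>j<m. 2 * R $$ (i, j) * n' i j) =
    2 * ((\<Sum>i<m. \<Sum>j<m. R $$ (i, j) * plane_rot_deriv p q j (\<lambda>k. N $$ (i, k))) +
      (\<Sum>j<m. \<Sum>i<m. R $$ (i, j) * plane_rot_deriv p q i (\<lambda>l. N $$ (l, j))))"
    by (subst (3) sum.swap)
      (simp add: n'_def distrib_left sum.distrib sum_distrib_left mult.assoc)
  also have "\<dots> = 4 * C"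
  proof -
    have "(\<Sum>i<m. \<Sum>j<m. R $$ (i, j) * plane_rot_deriv p q j (\<lambda>k. N $$ (i, k))) = C"
      unfolding sum_deriv C[symmetric] using pq
      by (intro sum.cong refl) (simp add: sym_entry[OF N(2,1)] sym_entry[OF R(2,1)])
    moreover have "(\<Sum>j<m. \<Sum>i<m. R $$ (i, j) * plane_rot_deriv p q i (\<lambda>l. N $$ (l, j))) = C"
      unfolding sum_deriv C[symmetric] by simp
    ultimately show ?thesis by simp
  qed
  finally have "(\<phi> has_real_derivative 4 * C) (at 0)" .
  then have "((\<lambda>\<theta>. sqrt (\<phi> \<theta>)) has_real_derivative inverse (sqrt (\<phi> 0)) / 2 * (4 * C)) (at 0)"
    by (rule DERIV_chain2[where g = \<phi> and x = 0, OF DERIV_real_sqrt[OF \<open>\<phi> 0 > 0\<close>]])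
  moreover have "(\<lambda>\<theta>. sqrt (\<phi> \<theta>)) = f" by (rule ext) (rule f[symmetric])
  moreover have "inverse (sqrt (\<phi> 0)) / 2 * (4 * C) = 2 * C / frob R"
    unfolding f0[symmetric] f[of 0] by (simp add: inverse_eq_divide)
  ultimately have df: "(f has_real_derivative 2 * C / frob R) (at 0)" by simp
  \<comment> \<open>Minimality of \<open>Q\<close> is tested against \<open>Q * G \<theta>\<close>:
    the residual part of the objective becomes \<open>f \<theta>\<close>, while the penalty grows by
    at most \<open>e * m^2 * 2 * |\<theta>|\<close>.\<close>
  have "f 0 - (2 * real m ^ 2 * e) * \<bar>\<theta>\<bar> \<le> f \<theta>" for \<theta>
  proof -
    have QG: "Q * G \<theta> \<in> carrier_mat m m" using Q G by simp
    have carr: "transpose_mat (Q * G \<theta>) \<in> carrier_mat m m" "transpose_mat Q \<in> carrier_mat m m"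
      "transpose_mat (G \<theta>) \<in> carrier_mat m m"
      using Q G QG by auto
    \<comment> \<open>Orthogonality of the product is \<open>conj_mult\<close> with the identity in
      place of \<open>M\<close>.\<close>
    have "transpose_mat (Q * G \<theta>) * (Q * G \<theta>) = transpose_mat (Q * G \<theta>) * 1\<^sub>m m * (Q * G \<theta>)"
      using right_mult_one_mat[OF carr(1)] by simp
    also have "\<dots> = transpose_mat (G \<theta>) * (transpose_mat Q * 1\<^sub>m m * Q) * G \<theta>"
      by (rule conj_mult[OF _ Q(1) G(1)]) simp
    also have "\<dots> = 1\<^sub>m m"
      using right_mult_one_mat[OF carr(2)] right_mult_one_mat[OF carr(3)] Q(2) G(2) by simp
    finally have "frob R + e * l1 (Q - 1\<^sub>m m) \<le> f \<theta> + e * l1 (Q * G \<theta> - 1\<^sub>m m)"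
      using least[OF QG] conj_mult[OF M(1) Q(1) G(1)] by (simp add: f_def R_def N_def)
    moreover have "l1 (Q * G \<theta> - 1\<^sub>m m) \<le> l1 (Q - 1\<^sub>m m) + real m ^ 2 * (2 * \<bar>\<theta>\<bar>)"
    proof -
      have "(Q * G \<theta> - 1\<^sub>m m) - (Q - 1\<^sub>m m) = Q * G \<theta> - Q"
        using Q(1) QG by (intro eq_matI) (auto simp del: index_mult_mat(1))
      moreover have "l1 (Q * G \<theta> - Q) \<le> real m ^ 2 * (2 * \<bar>\<theta>\<bar>)"
      proof (rule l1_le)
        show "Q * G \<theta> - Q \<in> carrier_mat m m" using Q(1) by (rule minus_carrier_mat)
        fix i j assume ij: "i < m" "j < m"
        \<comment> \<open>Rows are continued by 0 beyond \<open>m\<close>, since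
          \<open>plane_rot_diff_le\<close> wants a bound at every index.\<close>
        have "(Q * G \<theta> - Q) $$ (i, j) =
          plane_rot p q \<theta> j (\<lambda>k. if k < m then Q $$ (i, k) else 0) - (if j < m then Q $$ (i, j) else 0)"
          using Q(1) ij pq QG unfolding G_def
          by (simp add: index_mult_givens plane_rot_def del: index_mult_mat(1))
        then show "\<bar>(Q * G \<theta> - Q) $$ (i, j)\<bar> \<le> 2 * \<bar>\<theta>\<bar>"
          using plane_rot_diff_le[of "\<lambda>k. if k < m then Q $$ (i, k) else 0" p q \<theta> j]
            orthogonal_entry_le[OF Q ij(1)] by auto
      qed
      moreover have "l1 (Q * G \<theta> - 1\<^sub>m m) \<le> l1 (Q - 1\<^sub>m m) + l1 ((Q * G \<theta> - 1\<^sub>m m) - (Q - 1\<^sub>m m))"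
        by (rule l1_triangle_le[of _ m]) (auto intro: minus_carrier_mat)
      ultimately show ?thesis by simp
    qed
    then have "e * l1 (Q * G \<theta> - 1\<^sub>m m) \<le> e * l1 (Q - 1\<^sub>m m) + (2 * real m ^ 2 * e) * \<bar>\<theta>\<bar>"
      using mult_left_mono[OF _ \<open>e \<ge> 0\<close>] by (force simp: algebra_simps)
    ultimately show ?thesis by (simp add: f0)
  qed
  from DERIV_bound_of_ge_cone[OF df this]
  have "\<bar>2 * C / frob R\<bar> \<le> 2 * real m ^ 2 * e" .
  moreover have "frob R > 0" using nz frob_nonneg[of R] by (auto simp: R_def N_def)
  ultimately show ?thesis
    unfolding C_def[symmetric] R_def[symmetric] by (simp add: abs_mult field_simps)
qed

lemma continuous_on_conj_entry:
  fixes M :: "real mat"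
  assumes "M \<in> carrier_mat m m" "i < m" "j < m"
  shows "continuous_on UNIV (\<lambda>q. (transpose_mat (mat m m q) * M * mat m m q) $$ (i, j))"
proof -
  have eq: "(transpose_mat (mat m m q) * M * mat m m q) $$ (i, j) =
    (\<Sum>k<m. (\<Sum>l<m. q (l, i) * M $$ (l, k)) * q (k, j))" for q
    using assms by (simp add: index_mult_sum[of _ m m _ m] mult_carrier_mat[of _ m m] del: index_mult_mat(1))
  show ?thesis
    unfolding eq by (intro continuous_intros continuous_on_product_coordinates)
qed

text \<open>Plays the part of an inverse function theorem: injectivity of the commutator says that
  the orthogonal orbit of \<open>M\<close> is transversal to the matrices vanishing on
  \<open>W\<close>. For \<open>T = 0\<close> the solution is \<open>M\<close> itself, and
  \<open>\<delta>\<close> is uniform in \<open>T\<close>.\<close>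

lemma isospectral_with_prescribed_entries:
  assumes M: "M \<in> carrier_mat m m" "transpose_mat M = M"
    and W: "\<And>i j. W i j \<Longrightarrow> W j i"
    and M0: "\<And>i j. i < m \<Longrightarrow> j < m \<Longrightarrow> W i j \<Longrightarrow> M $$ (i, j) = 0"
    and inj: "\<And>X. supported m W X \<Longrightarrow> commutator M X = 0\<^sub>m m m \<Longrightarrow> X = 0\<^sub>m m m"
    and "\<epsilon> > 0"
  obtains \<delta> where "\<delta> > 0"
    "\<And>T. T \<in> carrier_mat m m \<Longrightarrow> transpose_mat T = T \<Longrightarrow> l1 T < \<delta> \<Longrightarrow>
      \<exists>N. N \<in> carrier_mat m m \<and> transpose_mat N = N \<and> char_poly N = char_poly M \<and>
        (\<forall>i<m. \<forall>j<m. \<bar>N $$ (i, j) - M $$ (i, j)\<bar> < \<epsilon>) \<and>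
        (\<forall>i<m. \<forall>j<m. W i j \<longrightarrow> N $$ (i, j) = T $$ (i, j))"
proof -
  obtain \<sigma> where "\<sigma> > 0" and \<sigma>: "\<And>N X. N \<in> carrier_mat m m \<Longrightarrow>
      (\<And>i j. i < m \<Longrightarrow> j < m \<Longrightarrow> \<bar>N $$ (i, j) - M $$ (i, j)\<bar> \<le> \<sigma>) \<Longrightarrow>
      supported m W X \<Longrightarrow> \<sigma> * l1 X \<le> l1 (commutator N X)"
    using commutator_bounded_below_near[OF M(1) inj] by blast
  define \<eta> where "\<eta> = min \<epsilon> \<sigma>"
  \<comment> \<open>Small enough for \<open>m^5 * e < \<sigma>\<close>. The power collects
    \<open>m^2\<close> from stationarity, \<open>m^2\<close> from summing over the entries of the
    commutator and \<open>m\<close> from \<open>frob_le_l1\<close>.\<close>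
  define e where "e = \<sigma> / (real m ^ 5 + 1)"
  \<comment> \<open>With \<open>l1 (Q - 1) \<le> m * \<eta> / (c + 1)\<close>, which the choice of
    \<open>\<delta>\<close> enforces, the entries of \<open>N - M\<close> turn out to be at most
    \<open>c * \<eta> / (c + 1) < \<eta>\<close>.\<close>
  define c where "c = real m * (real m * ((real m + 1) * l1 M))"
  define \<delta> where "\<delta> = e * \<eta> / (c + 1)"
  have "e > 0" using \<open>\<sigma> > 0\<close> by (simp add: e_def add_nonneg_pos)
  have "\<eta> > 0" using \<open>\<sigma> > 0\<close> \<open>\<epsilon> > 0\<close> by (simp add: \<eta>_def)
  have "c \<ge> 0" by (simp add: c_def l1_nonneg)
  have "real m ^ 5 * e < \<sigma>"
  proof -
    have "real m ^ 5 * \<sigma> < \<sigma> * (real m ^ 5 + 1)" using \<open>\<sigma> > 0\<close> by (simp add: algebra_simps)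
    then show ?thesis by (simp add: e_def pos_divide_less_eq add_nonneg_pos)
  qed
  show ?thesis
  proof (rule that)
    show "\<delta> > 0" using \<open>e > 0\<close> \<open>\<eta> > 0\<close> \<open>c \<ge> 0\<close> by (simp add: \<delta>_def)
    fix T :: "real mat" assume T: "T \<in> carrier_mat m m" "transpose_mat T = T" "l1 T < \<delta>"
    define obj where
      "obj Q = frob (residual m W T (transpose_mat Q * M * Q)) + e * l1 (Q - 1\<^sub>m m)" for Q
    have one: "1\<^sub>m m \<in> carrier_mat m m" "transpose_mat (1\<^sub>m m) * 1\<^sub>m m = (1\<^sub>m m :: real mat)" by auto
    \<comment> \<open>The orthogonal matrices form a closed set with entries bounded by 1, so the
      objective has a minimiser.\<close>
    obtain Q where Q: "Q \<in> carrier_mat m m" "transpose_mat Q * Q = 1\<^sub>m m"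
      and least: "\<And>Y. Y \<in> carrier_mat m m \<Longrightarrow> transpose_mat Y * Y = 1\<^sub>m m \<Longrightarrow> obj Q \<le> obj Y"
    proof (rule mat_attains_inf[of "\<lambda>Q. transpose_mat Q * Q = 1\<^sub>m m" m obj "1\<^sub>m m"])
      have "{q. transpose_mat (mat m m q) * mat m m q = (1\<^sub>m m :: real mat)} =
        {q. \<forall>i j. i < m \<longrightarrow> j < m \<longrightarrow> (\<Sum>k<m. q (k, i) * q (k, j)) = (if i = j then 1 else 0)}"
        by (auto simp: mat_eq_iff index_mult_sum[of _ m m _ m] simp del: index_mult_mat(1))
      also have "closed \<dots>"
        by (intro closed_Collect_all closed_Collect_imp closed_Collect_eq open_Collect_const
            continuous_intros continuous_on_product_coordinates)
      finally show "closed {q. transpose_mat (mat m m q) * mat m m q = (1\<^sub>m m :: real mat)}" .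
      have "continuous_on UNIV (\<lambda>q. residual m W T (transpose_mat (mat m m q) * M * mat m m q) $$ (i, j))"
        if "i < m" "j < m" for i j
        using that continuous_on_conj_entry[OF M(1) that]
        by (cases "W i j") (auto simp: residual_def intro!: continuous_intros simp del: index_mult_mat(1))
      then have "continuous_on UNIV (\<lambda>q. frob (residual m W T (transpose_mat (mat m m q) * M * mat m m q)))"
        unfolding frob_carrier[OF residual_carrier] by (intro continuous_intros) auto
      moreover have "continuous_on UNIV (\<lambda>q. l1 (mat m m q - 1\<^sub>m m))"
        by (rule continuous_on_l1_mat[of "\<lambda>X. X - 1\<^sub>m m"]) (auto intro!: continuous_intros)
      ultimately show "continuous_on UNIV (\<lambda>q. obj (mat m m q))"
        unfolding obj_def by (intro continuous_intros)
    qed (use orthogonal_entry_le in auto)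
    define N where "N = transpose_mat Q * M * Q"
    have N: "N \<in> carrier_mat m m" "transpose_mat N = N"
      using M Q transpose_conj by (auto simp: N_def)
    have QM: "transpose_mat Q * M \<in> carrier_mat m m"
      using M Q by (intro mult_carrier_mat[of _ m m]) auto
    have D: "Q - 1\<^sub>m m \<in> carrier_mat m m" by (simp add: minus_carrier_mat)
    have "obj (1\<^sub>m m) = frob (residual m W T M)"
      using M(1) by (simp add: obj_def l1_def)
    also have "\<dots> \<le> real m * l1 (residual m W T M)"
      by (rule frob_le_l1) simp
    finally have "obj (1\<^sub>m m) \<le> real m * l1 (residual m W T M)" .
    \<comment> \<open>\<open>M\<close> vanishes on \<open>W\<close>, so its residual there is just
      \<open>- T\<close>.\<close>
    moreover have "l1 (residual m W T M) \<le> l1 T"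
      unfolding l1_carrier[OF T(1)] l1_carrier[OF residual_carrier]
      by (intro sum_mono) (auto simp: residual_def M0)
    ultimately have "obj (1\<^sub>m m) \<le> real m * \<delta>"
      using T(3) by (meson mult_left_mono of_nat_0_le_iff order_trans less_imp_le)
    then have "obj Q \<le> real m * \<delta>"
      using least[OF one] by simp
    then have "e * l1 (Q - 1\<^sub>m m) \<le> real m * \<delta>"
      using frob_nonneg[of "residual m W T (transpose_mat Q * M * Q)"] by (simp add: obj_def)
    then have close: "l1 (Q - 1\<^sub>m m) \<le> real m * (\<eta> / (c + 1))"
    proof -
      have "real m * \<delta> = e * (real m * (\<eta> / (c + 1)))" by (simp add: \<delta>_def)
      with \<open>e * l1 (Q - 1\<^sub>m m) \<le> real m * \<delta>\<close> show ?thesis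
        using \<open>e > 0\<close> by (simp only: mult_le_cancel_left_pos)
    qed
    \<comment> \<open>\<open>N - M\<close> is split as \<open>Q^T M (Q - I) + (Q - I)^T M\<close>;
      both terms are small because \<open>Q\<close> is close to the identity.\<close>
    have near: "\<bar>N $$ (i, j) - M $$ (i, j)\<bar> < \<eta>" if "i < m" "j < m" for i j
    proof -
      define \<kappa> where "\<kappa> = real m * (\<eta> / (c + 1))"
      have small: "\<bar>(Q - 1\<^sub>m m) $$ (k, l)\<bar> \<le> \<kappa>" if "k < m" "l < m" for k l
        using entry_le_l1[OF D that] close by (simp add: \<kappa>_def)
      have small': "\<bar>transpose_mat (Q - 1\<^sub>m m) $$ (k, l)\<bar> \<le> \<kappa>" if "k < m" "l < m" for k l
        using small[OF that(2,1)] that Q(1) by simp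
      have "\<kappa> \<ge> 0" using \<open>\<eta> > 0\<close> \<open>c \<ge> 0\<close> by (simp add: \<kappa>_def)
      have "l1 (transpose_mat Q * M) \<le> real m * 1 * l1 M"
        using Q M(1) orthogonal_entry_le[OF Q] by (intro l1_mult_le(1)) auto
      then have "real m * \<kappa> * l1 (transpose_mat Q * M) \<le> real m * \<kappa> * (real m * l1 M)"
        using \<open>\<kappa> \<ge> 0\<close> by (intro mult_left_mono) auto
      moreover have "l1 (N - transpose_mat Q * M) \<le> real m * \<kappa> * l1 (transpose_mat Q * M)"
      proof -
        have "transpose_mat Q * M * (Q - 1\<^sub>m m) = N - transpose_mat Q * M"
          unfolding N_def using QM Q(1) by (subst mult_minus_distrib_mat[of _ m m]) auto
        with l1_mult_le(2)[OF D QM small] show ?thesis by simp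
      qed
      moreover have "\<bar>(N - transpose_mat Q * M) $$ (i, j)\<bar> \<le> l1 (N - transpose_mat Q * M)"
        using that QM by (intro entry_le_l1 minus_carrier_mat)
      moreover have "l1 (transpose_mat Q * M - M) \<le> real m * \<kappa> * l1 M"
      proof -
        have "transpose_mat (Q - 1\<^sub>m m) * M = transpose_mat Q * M - M"
          using Q(1) M(1)
          by (subst transpose_minus[of _ m m], simp, simp, subst minus_mult_distrib_mat[of _ m m]) auto
        with l1_mult_le(1)[OF _ M(1) small'] D show ?thesis by simp
      qed
      moreover have "\<bar>(transpose_mat Q * M - M) $$ (i, j)\<bar> \<le> l1 (transpose_mat Q * M - M)"
        using that M(1) by (intro entry_le_l1 minus_carrier_mat)
      moreover have "N $$ (i, j) - M $$ (i, j) =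
        (N - transpose_mat Q * M) $$ (i, j) + (transpose_mat Q * M - M) $$ (i, j)"
        using that N(1) Q(1) M(1) by (simp del: index_mult_mat(1))
      ultimately have "\<bar>N $$ (i, j) - M $$ (i, j)\<bar> \<le> real m * \<kappa> * (real m * l1 M) + real m * \<kappa> * l1 M"
        by linarith
      also have "\<dots> = c * \<eta> / (c + 1)"
        by (simp add: \<kappa>_def c_def algebra_simps add_divide_distrib)
      also have "\<dots> < \<eta>"
        using \<open>\<eta> > 0\<close> \<open>c \<ge> 0\<close> by (simp add: pos_divide_less_eq add_nonneg_pos algebra_simps)
      finally show ?thesis .
    qed
    have "residual m W T N = 0\<^sub>m m m"
    proof (rule ccontr)
      define R where "R = residual m W T N"
      assume "\<not> ?thesis"
      then have "l1 R \<noteq> 0" using l1_eq_0[of R m] by (auto simp: R_def)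
      then have "l1 R > 0" using l1_nonneg[of R] by simp
      have R: "supported m W R" "R \<in> carrier_mat m m"
        using supported_residual[OF N T(1,2) W] by (auto simp: R_def)
      have nz: "frob R \<noteq> 0"
      proof
        assume "frob R = 0"
        then have "(\<Sum>i<m. \<Sum>j<m. (R $$ (i, j))\<^sup>2) = 0" by (simp add: frob_carrier[OF R(2)])
        then have "R $$ (i, j) = 0" if "i < m" "j < m" for i j
          using that by (simp add: sum_nonneg_eq_0_iff sum_nonneg)
        then show False using \<open>l1 R \<noteq> 0\<close> by (simp add: l1_carrier[OF R(2)])
      qed
      have "\<bar>commutator N R $$ (p, q)\<bar> \<le> real m ^ 2 * e * frob R" if pq: "p < m" "q < m" for p q
      proof (cases "p = q")
        case True
        have "R $$ (k, q) = R $$ (q, k)" "N $$ (k, q) = N $$ (q, k)" if "k < m" for k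
          using sym_entry[OF _ R(2), of q k] sym_entry[OF N(2,1), of q k] R(1) pq that
          by (auto simp: supported_def)
        then have "commutator N R $$ (p, q) = 0"
          using True pq by (simp add: index_commutator[OF N(1) R(2)] mult.commute)
        then show ?thesis using \<open>e > 0\<close> frob_nonneg by simp
      next
        case False
        show ?thesis
          unfolding R_def N_def
          by (rule commutator_residual_le[OF M T(1,2) W Q])
            (use \<open>e > 0\<close> least nz pq False in \<open>auto simp: obj_def R_def N_def\<close>)
      qed
      \<comment> \<open>The upper bound from stationarity meets the lower bound
        \<open>\<sigma> * l1 R\<close>, which is available for \<open>N\<close> because
        \<open>\<eta> \<le> \<sigma>\<close>.\<close>
      then have "l1 (commutator N R) \<le> real m ^ 2 * (real m ^ 2 * e * frob R)"
        by (intro l1_le) (auto simp: N R)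
      also have "\<dots> \<le> real m ^ 2 * (real m ^ 2 * e * (real m * l1 R))"
        using frob_le_l1[OF R(2)] \<open>e > 0\<close> by (intro mult_left_mono) auto
      also have "\<dots> = real m ^ 5 * e * l1 R" by (simp add: eval_nat_numeral)
      also have "\<dots> < \<sigma> * l1 R"
        using \<open>real m ^ 5 * e < \<sigma>\<close> \<open>l1 R > 0\<close> by (rule mult_strict_right_mono)
      also have "\<dots> \<le> l1 (commutator N R)"
        using near by (intro \<sigma> N R) (auto simp: \<eta>_def less_imp_le)
      finally show False by simp
    qed
    then have "N $$ (i, j) = T $$ (i, j)" if "i < m" "j < m" "W i j" for i j
    proof -
      have "residual m W T N $$ (i, j) = 0" using \<open>residual m W T N = 0\<^sub>m m m\<close> that by simp
      then show ?thesis using that by (simp add: residual_def)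
    qed
    then show "\<exists>N. N \<in> carrier_mat m m \<and> transpose_mat N = N \<and> char_poly N = char_poly M \<and>
        (\<forall>i<m. \<forall>j<m. \<bar>N $$ (i, j) - M $$ (i, j)\<bar> < \<epsilon>) \<and>
        (\<forall>i<m. \<forall>j<m. W i j \<longrightarrow> N $$ (i, j) = T $$ (i, j))"
      using N near char_poly_orthogonal_conj[OF M(1) Q]
      by (intro exI[of _ N]) (auto simp: N_def \<eta>_def)
  qed
qed

section \<open>Attaching a pendant vertex\<close>

definition nonadj :: "real mat \<Rightarrow> nat \<Rightarrow> nat \<Rightarrow> bool" where
  "nonadj A i j \<longleftrightarrow> i \<noteq> j \<and> A $$ (i, j) = 0"

lemma SSP_iff_commutator:
  assumes "A \<in> carrier_mat m m"
  shows "SSP A \<longleftrightarrow> (\<forall>X. supported m (nonadj A) X \<and> commutator A X = 0\<^sub>m m m \<longrightarrow> X = 0\<^sub>m m m)"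
proof -
  have "hadamard A X = 0\<^sub>m m m \<and> hadamard (1\<^sub>m m) X = 0\<^sub>m m m \<longleftrightarrow>
    (\<forall>i<m. \<forall>j<m. \<not> nonadj A i j \<longrightarrow> X $$ (i, j) = 0)" for X
  proof -
    have "hadamard A X = 0\<^sub>m m m \<longleftrightarrow> (\<forall>i<m. \<forall>j<m. A $$ (i, j) = 0 \<or> X $$ (i, j) = 0)"
      using assms by (auto simp: hadamard_def mat_eq_iff)
    moreover have "hadamard (1\<^sub>m m) X = 0\<^sub>m m m \<longleftrightarrow> (\<forall>i<m. X $$ (i, i) = 0)"
      by (auto simp: hadamard_def mat_eq_iff)
    ultimately show ?thesis by (auto simp: nonadj_def)
  qed
  then show ?thesis
    using assms unfolding SSP_def supported_def commutator_def by (metis carrier_matD(1))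
qed

text \<open>The determinant is a polynomial in the entries, so singular matrices converging
  entrywise to \<open>K\<close> would force \<open>det K = 0\<close>.\<close>

lemma det_nonzero_near:
  fixes K :: "real mat"
  assumes K: "K \<in> carrier_mat k k" and "det K \<noteq> 0"
  obtains \<delta> where "\<delta> > 0" "\<And>L. L \<in> carrier_mat k k \<Longrightarrow>
    (\<And>i j. i < k \<Longrightarrow> j < k \<Longrightarrow> \<bar>L $$ (i, j) - K $$ (i, j)\<bar> < \<delta>) \<Longrightarrow> det L \<noteq> 0"
proof (rule ccontr)
  assume "\<not> thesis"
  have "\<exists>L. L \<in> carrier_mat k k \<and>
    (\<forall>i<k. \<forall>j<k. \<bar>L $$ (i, j) - K $$ (i, j)\<bar> < 1 / real (Suc n)) \<and> det L = 0" for n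
  proof (rule ccontr)
    assume no: "\<not> ?thesis"
    have thesis by (rule that[of "1 / real (Suc n)"]) (use no in auto)
    with \<open>\<not> thesis\<close> show False ..
  qed
  then obtain L where L: "\<And>n. L n \<in> carrier_mat k k" "\<And>n. det (L n) = 0"
    and near: "\<And>n i j. i < k \<Longrightarrow> j < k \<Longrightarrow> \<bar>L n $$ (i, j) - K $$ (i, j)\<bar> < 1 / real (Suc n)"
    by metis
  have lim: "(\<lambda>n. L n $$ (i, j)) \<longlonglongrightarrow> K $$ (i, j)" if "i < k" "j < k" for i j
    using near[OF that]
    by (intro metric_tendsto_imp_tendsto[OF LIMSEQ_inverse_real_of_nat] always_eventually allI)
      (auto simp: dist_real_def inverse_eq_divide intro: less_imp_le)
  have "(\<lambda>n. det (L n)) \<longlonglongrightarrow> det K"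
    unfolding det_def'[OF L(1)] det_def'[OF K]
    by (intro tendsto_sum tendsto_mult tendsto_const tendsto_prod lim) (auto simp: permutes_in_image)
  then have "(\<lambda>n. 0) \<longlonglongrightarrow> det K" by (simp add: L(2))
  then show False using \<open>det K \<noteq> 0\<close> LIMSEQ_unique tendsto_const by blast
qed

section \<open>Eigenvalues, characteristic polynomials and direct sums\<close>

lemma char_poly_nonzero:
  fixes A :: "real mat"
  assumes "A \<in> carrier_mat m m"
  shows "char_poly A \<noteq> 0"
  using degree_monic_char_poly[OF assms] by auto

lemma in_spec_iff:
  assumes "A \<in> carrier_mat m m"
  shows "l \<in># spec A \<longleftrightarrow> det (char_matrix A l) = 0"
  using char_poly_nonzero[OF assms] eigenvalue_root_char_poly[OF assms, of l] eigenvalue_det[OF assms, of l]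
  by (simp add: spec_def)

lemma index_char_matrix:
  fixes A :: "real mat"
  assumes "A \<in> carrier_mat m m" "i < m" "j < m"
  shows "char_matrix A l $$ (i, j) = A $$ (i, j) - (if i = j then l else 0)"
  using assms by (simp add: char_matrix_def)

text \<open>\<open>A - l I\<close> has trivial kernel. Phrased with sums over a function
  \<open>x\<close>, so that a column of a test matrix can be substituted directly.\<close>

lemma eigenvector_eq_0:
  fixes A :: "real mat"
  assumes A: "A \<in> carrier_mat m m" and det: "det (char_matrix A l) \<noteq> 0"
    and x: "\<And>i. i < m \<Longrightarrow> (\<Sum>k<m. A $$ (i, k) * x k) = l * x i"
    and "i < m"
  shows "x i = 0"
proof -
  have "char_matrix A l *\<^sub>v vec m x = 0\<^sub>v m"
  proof (rule eq_vecI)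
    fix i assume "i < dim_vec (0\<^sub>v m :: real vec)"
    then have i: "i < m" by simp
    have "(char_matrix A l *\<^sub>v vec m x) $ i = (\<Sum>k<m. char_matrix A l $$ (i, k) * x k)"
      using i carrier_matD[OF char_matrix_closed[OF A, of l]]
      by (simp add: scalar_prod_def atLeast0LessThan)
    also have "\<dots> = (\<Sum>k<m. A $$ (i, k) * x k) - (\<Sum>k<m. (if i = k then l * x k else 0))"
      unfolding sum_subtractf[symmetric] using i
      by (intro sum.cong refl) (simp add: index_char_matrix[OF A] algebra_simps)
    also have "\<dots> = 0" using x[OF i] i by simp
    finally show "(char_matrix A l *\<^sub>v vec m x) $ i = 0\<^sub>v m $ i" using i by simp
  qed (use A in \<open>auto simp: char_matrix_def\<close>)
  then have "vec m x = 0\<^sub>v m"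
    using det det_0_iff_vec_prod_zero_field[OF char_matrix_closed[OF A], of l] vec_carrier by blast
  then show ?thesis using \<open>i < m\<close> by (metis index_vec index_zero_vec(1))
qed

lemma char_poly_four_block_lower_left_zero:
  fixes A :: "real mat"
  assumes A: "A \<in> carrier_mat n n" "B \<in> carrier_mat n m" "D \<in> carrier_mat m m"
  shows "char_poly (four_block_mat A B (0\<^sub>m m n) D) = char_poly A * char_poly D"
proof -
  have "char_poly_matrix (four_block_mat A B (0\<^sub>m m n) D) =
    four_block_mat (char_poly_matrix A) (map_mat (\<lambda>a. [:- a:]) B) (0\<^sub>m m n) (char_poly_matrix D)"
    using A by (intro eq_matI) (auto simp: char_poly_matrix_def one_poly_def)
  then show ?thesis
    unfolding char_poly_def using A by (simp add: det_four_block_mat_lower_left_zero[of _ n _ m])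
qed

lemma char_poly_scalar: "char_poly (l \<cdot>\<^sub>m 1\<^sub>m s) = [:- l, 1:] ^ s" for l :: real
proof -
  have "diag_mat (l \<cdot>\<^sub>m 1\<^sub>m s) = replicate s l"
    by (intro nth_equalityI) (auto simp: diag_mat_def)
  then show ?thesis
    using char_poly_upper_triangular[of "l \<cdot>\<^sub>m 1\<^sub>m s" s] by (simp add: prod_list_replicate upper_triangular_def)
qed

text \<open>Supplies the size below which a perturbation cannot erase an edge. The inserted 1 keeps
  the minimum defined when \<open>S\<close> has no nonzero element.\<close>

lemma finite_positive_gap:
  assumes "finite S"
  obtains \<gamma> :: real where "\<gamma> > 0" "\<And>x. x \<in> S \<Longrightarrow> x \<noteq> 0 \<Longrightarrow> \<gamma> \<le> \<bar>x\<bar>"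
proof (rule that)
  have "finite (insert 1 (abs ` (S - {0})))" using assms by simp
  then show "Min (insert 1 (abs ` (S - {0}))) > 0" by (subst Min_gr_iff) auto
  show "Min (insert 1 (abs ` (S - {0}))) \<le> \<bar>x\<bar>" if "x \<in> S" "x \<noteq> 0" for x
    using that assms by (intro Min_le) auto
qed

lemma direct_sum_scalar_1_index:
  assumes "A \<in> carrier_mat n n" "i < Suc n" "j < Suc n"
  shows "direct_sum_scalar A l 1 $$ (i, j) =
    (if i < n \<and> j < n then A $$ (i, j) else if i = j then l else 0)"
  using assms by (auto simp: direct_sum_scalar_def)

lemma direct_sum_scalar_carrier:
  "A \<in> carrier_mat n n \<Longrightarrow> direct_sum_scalar A l s \<in> carrier_mat (n + s) (n + s)"
  by (simp add: direct_sum_scalar_def)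

text \<open>The leading block of a test matrix is a test matrix for \<open>A\<close>, hence zero.
  Its last column is then annihilated by \<open>A - l I\<close>, and the corner lies on the
  diagonal.\<close>

lemma SSP_direct_sum_scalar_1:
  assumes A: "A \<in> carrier_mat n n" and "SSP A" and l: "l \<notin># spec A"
  shows "SSP (direct_sum_scalar A l 1)"
proof -
  define M where "M = direct_sum_scalar A l 1"
  have M: "M \<in> carrier_mat (Suc n) (Suc n)"
    using direct_sum_scalar_carrier[OF A, of l 1] by (simp add: M_def)
  have det: "det (char_matrix A l) \<noteq> 0" using l in_spec_iff[OF A] by simp
  have M_index: "M $$ (i, j) = (if i < n \<and> j < n then A $$ (i, j) else if i = j then l else 0)"
    if "i < Suc n" "j < Suc n" for i j
    unfolding M_def using direct_sum_scalar_1_index[OF A that] .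
  have "X = 0\<^sub>m (Suc n) (Suc n)"
    if X: "supported (Suc n) (nonadj M) X" and comm: "commutator M X = 0\<^sub>m (Suc n) (Suc n)" for X
  proof -
    have carr: "X \<in> carrier_mat (Suc n) (Suc n)" and sym: "transpose_mat X = X"
      and zero: "\<And>i j. i < Suc n \<Longrightarrow> j < Suc n \<Longrightarrow> \<not> nonadj M i j \<Longrightarrow> X $$ (i, j) = 0"
      using X by (auto simp: supported_def)
    have comm': "(\<Sum>k<Suc n. M $$ (i, k) * X $$ (k, j)) = (\<Sum>k<Suc n. X $$ (i, k) * M $$ (k, j))"
      if "i < Suc n" "j < Suc n" for i j
      using arg_cong[OF comm, of "\<lambda>Y. Y $$ (i, j)"] that index_commutator[OF M carr that] by simp
    define Y where "Y = mat n n (\<lambda>p. X $$ p)"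
    have Y: "Y \<in> carrier_mat n n" by (simp add: Y_def)
    have "supported n (nonadj A) Y"
      unfolding supported_def using zero sym_entry[OF sym carr]
      by (auto simp: Y_def nonadj_def M_index sym_iff[of _ n])
    moreover have "commutator A Y = 0\<^sub>m n n"
    proof (rule eq_matI)
      fix i j assume "i < dim_row (0\<^sub>m n n :: real mat)" "j < dim_col (0\<^sub>m n n :: real mat)"
      then have ij: "i < n" "j < n" by auto
      then show "commutator A Y $$ (i, j) = 0\<^sub>m n n $$ (i, j)"
        using comm'[of i j] by (simp add: index_commutator[OF A Y]) (simp add: Y_def M_index)
    qed (use A in \<open>auto simp: Y_def commutator_def\<close>)
    ultimately have "Y = 0\<^sub>m n n"
      using \<open>SSP A\<close> SSP_iff_commutator[OF A] by blast
    then have X1: "X $$ (i, j) = 0" if "i < n" "j < n" for i j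
      using that unfolding Y_def by (metis index_mat(1) index_zero_mat(1))
    have X2: "X $$ (i, n) = 0" if "i < n" for i
    proof (rule eigenvector_eq_0[OF A det _ that])
      fix i assume "i < n"
      then show "(\<Sum>k<n. A $$ (i, k) * X $$ (k, n)) = l * X $$ (i, n)"
        using comm'[of i n] X1 by (simp add: M_index)
    qed
    have "X $$ (n, i) = 0" if "i < Suc n" for i
      using that X2[of i] sym_entry[OF sym carr, of i n] zero[of n n] by (cases "i = n") (auto simp: nonadj_def)
    then show ?thesis
      using X1 X2 carr by (intro eq_matI) (auto simp: less_Suc_eq)
  qed
  then show ?thesis
    using SSP_iff_commutator[OF M] by (simp add: M_def)
qed

text \<open>Expanding along the last column and then the last row, where only the entry at \<open>u\<close> survives,
  leaves the principal minor obtained by deleting \<open>u\<close> and \<open>n\<close>.\<close>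

lemma det_pendant_nonzero:
  fixes K :: "real mat"
  assumes K: "K \<in> carrier_mat (Suc n) (Suc n)" and u: "u < n"
    and col: "\<And>i. i \<le> n \<Longrightarrow> K $$ (i, n) \<noteq> 0 \<longleftrightarrow> i = u"
    and row: "\<And>i. i \<le> n \<Longrightarrow> K $$ (n, i) \<noteq> 0 \<longleftrightarrow> i = u"
    and B: "B \<in> carrier_mat n n" "\<And>i j. i < n \<Longrightarrow> j < n \<Longrightarrow> B $$ (i, j) = K $$ (i, j)"
    and det: "det (mat_delete B u u) \<noteq> 0"
  shows "det K \<noteq> 0"
proof -
  define L where "L = mat_delete K u n"
  have L: "L \<in> carrier_mat n n" using mat_delete_carrier[OF K] by (simp add: L_def)
  \<comment> \<open>Deleting row \<open>u < n\<close> moves row \<open>n\<close> of \<open>K\<close>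
    up to position \<open>n - 1\<close>; removing that row and column \<open>u\<close> next leaves
    the minor of the leading block \<open>B\<close> without \<open>u\<close>.\<close>
  have Ln: "L $$ (n - 1, j) = K $$ (n, j)" if "j < n" for j
    using u K that by (auto simp: L_def mat_delete_def)
  have "mat_delete L (n - 1) u = mat_delete B u u"
    using u K B by (intro eq_matI) (auto simp: L_def mat_delete_def)
  moreover have "det L = (\<Sum>j<n. if j = u then K $$ (n, u) * cofactor L (n - 1) u else 0)"
  proof (subst laplace_expansion_row[OF L, of "n - 1"], use u in simp, intro sum.cong refl)
    fix j assume "j \<in> {..<n}"
    then show "L $$ (n - 1, j) * cofactor L (n - 1) j = (if j = u then K $$ (n, u) * cofactor L (n - 1) u else 0)"
      using row[of j] Ln[of j] by auto
  qed
  ultimately have "det L \<noteq> 0"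
    using det row[of u] u by (simp add: cofactor_def)
  moreover have "det K = (\<Sum>i<Suc n. if i = u then K $$ (u, n) * cofactor K u n else 0)"
  proof (subst laplace_expansion_column[OF K, of n], simp, intro sum.cong refl)
    fix i assume "i \<in> {..<Suc n}"
    then show "K $$ (i, n) * cofactor K i n = (if i = u then K $$ (u, n) * cofactor K u n else 0)"
      using col[of i] by auto
  qed
  ultimately show ?thesis
    using col[of u] u by (simp add: cofactor_def L_def del: sum.lessThan_Suc)
qed

text \<open>The case \<open>s = 1\<close>, enriched by what the passage to a clique needs: a last
  diagonal entry other than \<open>l\<close> makes the clique vertices adjacent, and
  \<open>l\<close> not being an eigenvalue of the leading block makes the new columns of a test
  matrix vanish.\<close>

lemma pendant_extension:
  assumes A: "A \<in> carrier_mat n n" "transpose_mat A = A" and ssp: "SSP A" and u: "u < n"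
    and l: "l \<notin># spec A" "l \<notin># spec (mat_delete A u u)" and "\<epsilon> > 0"
  obtains N where "N \<in> carrier_mat (Suc n) (Suc n)" "transpose_mat N = N" "SSP N"
    "char_poly N = char_poly A * [:- l, 1:]"
    "\<And>i j. i < Suc n \<Longrightarrow> j < Suc n \<Longrightarrow> \<bar>N $$ (i, j) - direct_sum_scalar A l 1 $$ (i, j)\<bar> < \<epsilon>"
    "\<And>i j. i < n \<Longrightarrow> j < n \<Longrightarrow> i \<noteq> j \<Longrightarrow> N $$ (i, j) \<noteq> 0 \<longleftrightarrow> A $$ (i, j) \<noteq> 0"
    "\<And>i. i < n \<Longrightarrow> N $$ (i, n) \<noteq> 0 \<longleftrightarrow> i = u"
    "N $$ (n, n) \<noteq> l"
    "det (char_matrix (mat n n (($$) N)) l) \<noteq> 0"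
proof -
  define M where "M = direct_sum_scalar A l 1"
  have M: "M \<in> carrier_mat (Suc n) (Suc n)"
    using direct_sum_scalar_carrier[OF A(1), of l 1] by (simp add: M_def)
  have M_index: "M $$ (i, j) = (if i < n \<and> j < n then A $$ (i, j) else if i = j then l else 0)"
    if "i < Suc n" "j < Suc n" for i j
    unfolding M_def using direct_sum_scalar_1_index[OF A(1) that] .
  have M_sym: "transpose_mat M = M"
    unfolding sym_iff[OF M] using sym_entry[OF A(2,1)] by (auto simp: M_index)
  have M_char: "char_poly M = char_poly A * [:- l, 1:]"
    using char_poly_four_block_lower_left_zero[of A n "0\<^sub>m n 1" 1 "l \<cdot>\<^sub>m 1\<^sub>m 1"] A(1)
    by (simp only: M_def direct_sum_scalar_def char_poly_scalar carrier_matD power_one_right) simp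
  have W: "nonadj M j i" if "nonadj M i j" "i < Suc n" "j < Suc n" for i j
    using that sym_entry[OF M_sym M] by (simp add: nonadj_def)
  \<comment> \<open>Cut down to the index range because symmetry of the pattern is demanded for all
    naturals, while \<open>M\<close> is symmetric only inside its dimensions.\<close>
  define W where "W i j \<longleftrightarrow> i < Suc n \<and> j < Suc n \<and> nonadj M i j" for i j
  have supp: "supported (Suc n) W X \<longleftrightarrow> supported (Suc n) (nonadj M) X" for X
    by (auto simp: supported_def W_def)
  have inj: "X = 0\<^sub>m (Suc n) (Suc n)" if "supported (Suc n) W X" "commutator M X = 0\<^sub>m (Suc n) (Suc n)" for X
    using SSP_direct_sum_scalar_1[OF A(1) ssp l(1)] that SSP_iff_commutator[OF M]
    unfolding M_def[symmetric] supp by blast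
  obtain \<sigma> where "\<sigma> > 0" and \<sigma>: "\<And>N X. N \<in> carrier_mat (Suc n) (Suc n) \<Longrightarrow>
      (\<And>i j. i < Suc n \<Longrightarrow> j < Suc n \<Longrightarrow> \<bar>N $$ (i, j) - M $$ (i, j)\<bar> \<le> \<sigma>) \<Longrightarrow>
      supported (Suc n) W X \<Longrightarrow> \<sigma> * l1 X \<le> l1 (commutator N X)"
    using commutator_bounded_below_near[OF M inj] by blast
  have cA: "char_matrix A l \<in> carrier_mat n n" using A(1) by simp
  have dA: "mat_delete A u u \<in> carrier_mat (n - 1) (n - 1)" using A(1) by (rule mat_delete_carrier)
  obtain \<delta>1 where "\<delta>1 > 0" and \<delta>1: "\<And>L. L \<in> carrier_mat n n \<Longrightarrow>
      (\<And>i j. i < n \<Longrightarrow> j < n \<Longrightarrow> \<bar>L $$ (i, j) - char_matrix A l $$ (i, j)\<bar> < \<delta>1) \<Longrightarrow> det L \<noteq> 0"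
    by (rule det_nonzero_near[OF cA]) (use l(1) in_spec_iff[OF A(1)] in auto)
  obtain \<delta>2 where "\<delta>2 > 0" and \<delta>2: "\<And>L. L \<in> carrier_mat (n - 1) (n - 1) \<Longrightarrow>
      (\<And>i j. i < n - 1 \<Longrightarrow> j < n - 1 \<Longrightarrow>
        \<bar>L $$ (i, j) - char_matrix (mat_delete A u u) l $$ (i, j)\<bar> < \<delta>2) \<Longrightarrow> det L \<noteq> 0"
    by (rule det_nonzero_near[OF char_matrix_closed[OF dA, of l]]) (use l(2) in_spec_iff[OF dA] in auto)
  obtain \<gamma> where "\<gamma> > 0" and "\<And>x. x \<in> ($$) A ` ({..<n} \<times> {..<n}) \<Longrightarrow> x \<noteq> 0 \<Longrightarrow> \<gamma> \<le> \<bar>x\<bar>"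
    using finite_positive_gap[of "($$) A ` ({..<n} \<times> {..<n})"] by auto
  then have \<gamma>: "\<gamma> \<le> \<bar>A $$ (i, j)\<bar>" if "i < n" "j < n" "A $$ (i, j) \<noteq> 0" for i j
    using that by auto
  \<comment> \<open>In this order the bounds secure closeness, the strong spectral property of
    \<open>N\<close>, \<open>l\<close> not being an eigenvalue of the leading block, a nonzero minor
    without \<open>u\<close>, and the survival of all edges of \<open>A\<close>.\<close>
  define \<eta> where "\<eta> = Min {\<epsilon>, \<sigma>, \<delta>1, \<delta>2, \<gamma>}"
  have \<eta>: "\<eta> > 0" "\<eta> \<le> \<epsilon>" "\<eta> \<le> \<sigma>" "\<eta> \<le> \<delta>1" "\<eta> \<le> \<delta>2" "\<eta> \<le> \<gamma>"
    using \<open>\<epsilon> > 0\<close> \<open>\<sigma> > 0\<close> \<open>\<delta>1 > 0\<close> \<open>\<delta>2 > 0\<close> \<open>\<gamma> > 0\<close> by (auto simp: \<eta>_def)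
  obtain \<delta> where "\<delta> > 0" and \<delta>: "\<And>T. T \<in> carrier_mat (Suc n) (Suc n) \<Longrightarrow> transpose_mat T = T \<Longrightarrow> l1 T < \<delta> \<Longrightarrow>
      \<exists>N. N \<in> carrier_mat (Suc n) (Suc n) \<and> transpose_mat N = N \<and> char_poly N = char_poly M \<and>
        (\<forall>i<Suc n. \<forall>j<Suc n. \<bar>N $$ (i, j) - M $$ (i, j)\<bar> < \<eta>) \<and>
        (\<forall>i<Suc n. \<forall>j<Suc n. W i j \<longrightarrow> N $$ (i, j) = T $$ (i, j))"
    by (rule isospectral_with_prescribed_entries[OF M M_sym _ _ inj \<eta>(1), of W])
      (use W in \<open>auto simp: W_def nonadj_def\<close>)
  \<comment> \<open>The crude bound \<open>l1 T \<le> (n + 1)^2 * t\<close> then stays below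
    \<open>\<delta>\<close>.\<close>
  define t where "t = \<delta> / (real (Suc n) ^ 2 + 1)"
  have pos: "real (Suc n) ^ 2 + 1 > 0" by (intro add_nonneg_pos) auto
  have "t > 0" using \<open>\<delta> > 0\<close> pos by (simp only: t_def divide_pos_pos)
  \<comment> \<open>All positions in the last row and column off the diagonal are non-edges of
    \<open>M\<close>; \<open>T\<close> turns only the pair \<open>u\<close>, \<open>n\<close> into
    an edge and keeps every other non-edge.\<close>
  define T where "T = mat (Suc n) (Suc n) (\<lambda>(i, j). if i = u \<and> j = n \<or> i = n \<and> j = u then t else 0)"
  have T: "T \<in> carrier_mat (Suc n) (Suc n)" by (simp add: T_def)
  have "transpose_mat T = T" unfolding sym_iff[OF T] by (auto simp: T_def)
  moreover have "l1 T < \<delta>"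
  proof -
    have "l1 T \<le> real (Suc n) ^ 2 * t"
      using \<open>t > 0\<close> by (intro l1_le[OF T]) (auto simp: T_def)
    also have "\<dots> < (real (Suc n) ^ 2 + 1) * t" using \<open>t > 0\<close> by (simp add: algebra_simps)
    also have "\<dots> = \<delta>" using pos by (simp only: t_def) auto
    finally show ?thesis .
  qed
  ultimately obtain N where N: "N \<in> carrier_mat (Suc n) (Suc n)" "transpose_mat N = N" "char_poly N = char_poly M"
    and near: "\<And>i j. i < Suc n \<Longrightarrow> j < Suc n \<Longrightarrow> \<bar>N $$ (i, j) - M $$ (i, j)\<bar> < \<eta>"
    and NT: "\<And>i j. i < Suc n \<Longrightarrow> j < Suc n \<Longrightarrow> W i j \<Longrightarrow> N $$ (i, j) = T $$ (i, j)"
    using \<delta>[OF T] by blast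
  have adj: "N $$ (i, j) \<noteq> 0 \<longleftrightarrow> A $$ (i, j) \<noteq> 0" if "i < n" "j < n" "i \<noteq> j" for i j
  proof (cases "A $$ (i, j) = 0")
    case True
    then have "W i j" using that by (simp add: W_def nonadj_def M_index)
    then show ?thesis using NT[of i j] that True by (simp add: T_def)
  next
    case False
    then show ?thesis using near[of i j] \<gamma>[of i j] \<eta>(6) that by (auto simp: M_index)
  qed
  have pend: "N $$ (i, n) = (if i = u then t else 0)" if "i < n" for i
    using NT[of i n] that by (simp add: W_def nonadj_def M_index T_def)
  define B where "B = mat n n (($$) N)"
  have B: "B \<in> carrier_mat n n" by (simp add: B_def)
  have nearB: "\<bar>B $$ (i, j) - A $$ (i, j)\<bar> < \<eta>" if "i < n" "j < n" for i j
    using near[of i j] that by (simp add: B_def M_index)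
  have "SSP N"
    unfolding SSP_iff_commutator[OF N(1)]
  proof (intro allI impI)
    fix X assume X: "supported (Suc n) (nonadj N) X \<and> commutator N X = 0\<^sub>m (Suc n) (Suc n)"
    \<comment> \<open>\<open>N\<close> has only gained an edge, so its test matrices are supported
      on the non-edges of \<open>M\<close>, where the lower bound \<open>\<sigma>\<close>
      holds.\<close>
    have "nonadj M i j" if "nonadj N i j" "i < Suc n" "j < Suc n" for i j
      using that adj[of i j] by (auto simp: nonadj_def M_index)
    then have "supported (Suc n) W X"
      using X unfolding supported_def W_def by blast
    then have "\<sigma> * l1 X \<le> l1 (commutator N X)"
      using near \<eta>(3) by (intro \<sigma> N(1)) force+
    also have "\<dots> = 0" using X by (simp add: l1_def)
    finally have "l1 X = 0"
      using \<open>\<sigma> > 0\<close> l1_nonneg[of X] by (simp add: mult_le_0_iff)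
    then show "X = 0\<^sub>m (Suc n) (Suc n)"
      using X l1_eq_0 by (auto simp: supported_def)
  qed
  have "N $$ (n, n) \<noteq> l"
  proof
    assume eq: "N $$ (n, n) = l"
    have "char_matrix N l \<in> carrier_mat (Suc n) (Suc n)" using N(1) by simp
    moreover have "char_matrix N l $$ (i, n) \<noteq> 0 \<longleftrightarrow> i = u" if "i \<le> n" for i
      using that pend[of i] eq \<open>t > 0\<close> u by (cases "i = n") (auto simp: index_char_matrix[OF N(1)])
    moreover have "char_matrix N l $$ (n, i) \<noteq> 0 \<longleftrightarrow> i = u" if "i \<le> n" for i
      using that pend[of i] eq \<open>t > 0\<close> u sym_entry[OF N(2,1), of i n]
      by (cases "i = n") (auto simp: index_char_matrix[OF N(1)])
    moreover have "char_matrix B l $$ (i, j) = char_matrix N l $$ (i, j)" if "i < n" "j < n" for i j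
      using that by (simp add: index_char_matrix[OF N(1)] index_char_matrix[OF B]) (simp add: B_def)
    moreover have "det (mat_delete (char_matrix B l) u u) \<noteq> 0"
    proof (rule \<delta>2)
      have "char_matrix B l \<in> carrier_mat n n" using B by simp
      then show "mat_delete (char_matrix B l) u u \<in> carrier_mat (n - 1) (n - 1)"
        by (rule mat_delete_carrier)
      fix i j assume ij: "i < n - 1" "j < n - 1"
      \<comment> \<open>The positions before the deletion of \<open>u\<close>; diagonal entries stay
        diagonal, so deleting \<open>u\<close> commutes with subtracting \<open>l I\<close>.\<close>
      define i' j' where "i' = (if i < u then i else Suc i)" and "j' = (if j < u then j else Suc j)"
      have ij': "i' < n" "j' < n" "i' = j' \<longleftrightarrow> i = j" using ij by (auto simp: i'_def j'_def)
      have "mat_delete (char_matrix B l) u u $$ (i, j) = B $$ (i', j') - (if i = j then l else 0)"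
        using ij ij' B carrier_matD[OF char_matrix_closed[OF B, of l]]
        by (simp add: mat_delete_def i'_def[symmetric] j'_def[symmetric] index_char_matrix[OF B])
      moreover have "char_matrix (mat_delete A u u) l $$ (i, j) = A $$ (i', j') - (if i = j then l else 0)"
        using ij A(1) by (simp add: index_char_matrix[OF dA]) (simp add: mat_delete_def i'_def j'_def)
      ultimately show "\<bar>mat_delete (char_matrix B l) u u $$ (i, j) - char_matrix (mat_delete A u u) l $$ (i, j)\<bar> < \<delta>2"
        using nearB[OF ij'(1,2)] \<eta>(5) by simp
    qed
    ultimately have "det (char_matrix N l) \<noteq> 0"
      by (rule det_pendant_nonzero[OF _ u _ _ char_matrix_closed[OF B]])
    moreover have "l \<in># spec N"
      using N(3) M_char char_poly_nonzero[OF N(1)] by (simp add: spec_def)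
    ultimately show False using in_spec_iff[OF N(1)] by simp
  qed
  moreover have "det (char_matrix B l) \<noteq> 0"
  proof (rule \<delta>1)
    fix i j assume "i < n" "j < n"
    then show "\<bar>char_matrix B l $$ (i, j) - char_matrix A l $$ (i, j)\<bar> < \<delta>1"
      using nearB[of i j] \<eta>(4) by (simp add: index_char_matrix[OF B] index_char_matrix[OF A(1)])
  qed (use B in simp)
  moreover have "N $$ (i, n) \<noteq> 0 \<longleftrightarrow> i = u" if "i < n" for i
    using pend[OF that] \<open>t > 0\<close> by simp
  ultimately show ?thesis
    using near \<eta>(2) N M_char \<open>SSP N\<close> adj
    by (intro that[of N]) (force simp: M_def B_def)+
qed

section \<open>Spreading a vertex over a clique\<close>

text \<open>Vertex \<open>n\<close> of \<open>N\<close> is replaced by the clique \<open>{n..<n + s}\<close>, its weight being spread evenly along a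
  unit vector of \<open>\<real>\<^sup>s\<close>: the result is \<open>l I + J\<^sup>T (N - l I) J\<close> for a \<open>J\<close> with \<open>J J\<^sup>T = I\<close>.\<close>

definition spread_weight :: "nat \<Rightarrow> nat \<Rightarrow> nat \<Rightarrow> real" where
  "spread_weight n s i = (if i < n then 1 else 1 / sqrt (real s))"

text \<open>\<open>min i n\<close> sends every clique index to \<open>n\<close> and fixes the
  others, so each column has a single nonzero entry.\<close>

definition spread_mat :: "nat \<Rightarrow> nat \<Rightarrow> real mat" where
  "spread_mat n s = mat (Suc n) (n + s) (\<lambda>(a, i). if a = min i n then spread_weight n s i else 0)"

definition blowup :: "nat \<Rightarrow> nat \<Rightarrow> real \<Rightarrow> real mat \<Rightarrow> real mat" where
  "blowup n s l N = l \<cdot>\<^sub>m 1\<^sub>m (n + s) + transpose_mat (spread_mat n s) * char_matrix N l * spread_mat n s"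

lemma spread_mat_carrier [simp]: "spread_mat n s \<in> carrier_mat (Suc n) (n + s)"
  "transpose_mat (spread_mat n s) \<in> carrier_mat (n + s) (Suc n)"
  by (auto simp: spread_mat_def)

lemma blowup_carrier: "blowup n s l N \<in> carrier_mat (n + s) (n + s)"
  by (auto simp: blowup_def spread_mat_def)

lemma sum_spread_rows:
  assumes "i < n + s"
  shows "(\<Sum>a<Suc n. spread_mat n s $$ (a, i) * f a) = spread_weight n s i * f (min i n)"
proof -
  have "(\<Sum>a<Suc n. spread_mat n s $$ (a, i) * f a) =
    (\<Sum>a<Suc n. if a = min i n then spread_weight n s i * f (min i n) else 0)"
    using assms by (intro sum.cong) (auto simp: spread_mat_def)
  then show ?thesis by (simp del: sum.lessThan_Suc)
qed

lemma sum_spread_cols: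
  assumes "a < Suc n"
  shows "(\<Sum>i<n + s. spread_mat n s $$ (a, i) * f i) =
    (if a < n then f a else 1 / sqrt (real s) * (\<Sum>i\<in>{n..<n + s}. f i))"
proof -
  have "(\<Sum>i<n + s. spread_mat n s $$ (a, i) * f i) =
    (\<Sum>i<n. spread_mat n s $$ (a, i) * f i) + (\<Sum>i\<in>{n..<n + s}. spread_mat n s $$ (a, i) * f i)"
    by (simp add: lessThan_atLeast0 sum.atLeastLessThan_concat)
  also have "(\<Sum>i<n. spread_mat n s $$ (a, i) * f i) = (\<Sum>i<n. if i = a then f a else 0)"
    using assms by (intro sum.cong) (auto simp: spread_mat_def spread_weight_def)
  also have "(\<Sum>i\<in>{n..<n + s}. spread_mat n s $$ (a, i) * f i) =
    (\<Sum>i\<in>{n..<n + s}. if a = n then 1 / sqrt (real s) * f i else 0)"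
    using assms by (intro sum.cong) (auto simp: spread_mat_def spread_weight_def)
  finally show ?thesis
    using assms by (auto simp: sum_distrib_left)
qed

lemma spread_mat_orthonormal:
  assumes "s > 0"
  shows "spread_mat n s * transpose_mat (spread_mat n s) = 1\<^sub>m (Suc n)"
proof (rule eq_matI)
  fix a b assume "a < dim_row (1\<^sub>m (Suc n) :: real mat)" "b < dim_col (1\<^sub>m (Suc n) :: real mat)"
  then have ab: "a < Suc n" "b < Suc n" by auto
  have "(spread_mat n s * transpose_mat (spread_mat n s)) $$ (a, b) =
    (\<Sum>i<n + s. spread_mat n s $$ (a, i) * transpose_mat (spread_mat n s) $$ (i, b))"
    by (rule index_mult_sum) (use ab in auto)
  also have "\<dots> = (if a < n then transpose_mat (spread_mat n s) $$ (a, b)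
      else 1 / sqrt (real s) * (\<Sum>i\<in>{n..<n + s}. transpose_mat (spread_mat n s) $$ (i, b)))"
    by (rule sum_spread_cols[OF ab(1)])
  also have "\<dots> = 1\<^sub>m (Suc n) $$ (a, b)"
    using ab assms by (auto simp: spread_mat_def spread_weight_def)
  finally show "(spread_mat n s * transpose_mat (spread_mat n s)) $$ (a, b) = 1\<^sub>m (Suc n) $$ (a, b)" .
qed (auto simp: spread_mat_def)

lemma index_blowup:
  assumes N: "N \<in> carrier_mat (Suc n) (Suc n)" and ij: "i < n + s" "j < n + s"
  shows "blowup n s l N $$ (i, j) = (if i = j then l else 0) +
    spread_weight n s i * spread_weight n s j * char_matrix N l $$ (min i n, min j n)"
proof -
  define J K where "J = spread_mat n s" and "K = char_matrix N l"
  have J: "J \<in> carrier_mat (Suc n) (n + s)" "transpose_mat J \<in> carrier_mat (n + s) (Suc n)" by (auto simp: J_def)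
  have K: "K \<in> carrier_mat (Suc n) (Suc n)" using N by (simp add: K_def)
  have JK: "transpose_mat J * K \<in> carrier_mat (n + s) (Suc n)" using J(2) K by (rule mult_carrier_mat)
  have left: "(transpose_mat J * K) $$ (i, a) = spread_weight n s i * K $$ (min i n, a)" if "a < Suc n" for a
  proof -
    have "(transpose_mat J * K) $$ (i, a) = (\<Sum>b<Suc n. transpose_mat J $$ (i, b) * K $$ (b, a))"
      by (rule index_mult_sum[OF J(2) K ij(1) that])
    also have "\<dots> = (\<Sum>b<Suc n. J $$ (b, i) * K $$ (b, a))"
      using J(1) ij(1) by (intro sum.cong) auto
    finally show ?thesis unfolding J_def by (simp only: sum_spread_rows[OF ij(1)])
  qed
  have "(transpose_mat J * K * J) $$ (i, j) = (\<Sum>a<Suc n. (transpose_mat J * K) $$ (i, a) * J $$ (a, j))"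
    by (rule index_mult_sum[OF JK J(1) ij])
  also have "\<dots> = (\<Sum>a<Suc n. J $$ (a, j) * (spread_weight n s i * K $$ (min i n, a)))"
    using left by (intro sum.cong) auto
  also have "\<dots> = spread_weight n s j * (spread_weight n s i * K $$ (min i n, min j n))"
    unfolding J_def by (rule sum_spread_rows[OF ij(2)])
  finally show ?thesis
    using ij J JK unfolding blowup_def J_def[symmetric] K_def[symmetric]
    by (simp add: mult_ac del: index_mult_mat(1))
qed

text \<open>With \<open>K = N - l I\<close> and \<open>J J^T = I\<close> one has
  \<open>(l I + J^T K J) J^T = J^T (l I + K)\<close>: the columns of \<open>J^T\<close> span an
  invariant subspace on which the blow-up acts as \<open>N\<close>.\<close>

lemma blowup_mult_spread:
  assumes N: "N \<in> carrier_mat (Suc n) (Suc n)" and "s > 0"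
  shows "blowup n s l N * transpose_mat (spread_mat n s) = transpose_mat (spread_mat n s) * N"
proof -
  define J K where "J = spread_mat n s" and "K = char_matrix N l"
  have J: "J \<in> carrier_mat (Suc n) (n + s)" "transpose_mat J \<in> carrier_mat (n + s) (Suc n)" by (auto simp: J_def)
  have K: "K \<in> carrier_mat (Suc n) (Suc n)" using N by (simp add: K_def)
  have JK: "transpose_mat J * K \<in> carrier_mat (n + s) (Suc n)" using J(2) K by (rule mult_carrier_mat)
  have "blowup n s l N * transpose_mat J =
    l \<cdot>\<^sub>m 1\<^sub>m (n + s) * transpose_mat J + transpose_mat J * K * J * transpose_mat J"
    unfolding blowup_def J_def[symmetric] K_def[symmetric]
    using J JK by (intro add_mult_distrib_mat[of _ "n + s" "n + s"]) auto
  also have "l \<cdot>\<^sub>m 1\<^sub>m (n + s) * transpose_mat J = transpose_mat J * (l \<cdot>\<^sub>m 1\<^sub>m (Suc n))"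
    using J unfolding mult_smult_distrib[OF J(2) one_carrier_mat] mult_smult_assoc_mat[OF one_carrier_mat J(2)]
    by simp
  also have "transpose_mat J * K * J * transpose_mat J = transpose_mat J * K * (J * transpose_mat J)"
    using JK J by (rule assoc_mult_mat)
  also have "\<dots> = transpose_mat J * K"
    using right_mult_one_mat[OF JK] spread_mat_orthonormal[OF \<open>s > 0\<close>, of n] by (simp add: J_def)
  also have "transpose_mat J * (l \<cdot>\<^sub>m 1\<^sub>m (Suc n)) + transpose_mat J * K =
    transpose_mat J * (l \<cdot>\<^sub>m 1\<^sub>m (Suc n) + K)"
    using J K by (intro mult_add_distrib_mat[symmetric]) auto
  also have "l \<cdot>\<^sub>m 1\<^sub>m (Suc n) + K = N"
    using N by (intro eq_matI) (auto simp: K_def char_matrix_def)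
  finally show ?thesis by (simp add: J_def)
qed

text \<open>The invariant column space of \<open>J^T\<close> contains the image of
  \<open>A' - l I\<close>. In a basis extending these columns \<open>A'\<close> is therefore block
  triangular with diagonal blocks \<open>N\<close> and \<open>l I\<close>.\<close>

lemma char_poly_blowup:
  assumes N: "N \<in> carrier_mat (Suc n) (Suc n)" and "s > 0"
  shows "char_poly (blowup n s l N) = char_poly N * [:- l, 1:] ^ (s - 1)"
proof -
  define J K A' where "J = spread_mat n s" and "K = char_matrix N l" and "A' = blowup n s l N"
  \<comment> \<open>The basis: the \<open>n + 1\<close> columns of \<open>J^T\<close>, then the unit
    vectors of the last \<open>s - 1\<close> clique vertices. It is lower triangular with nonzero
    diagonal, hence invertible.\<close>
  define P where "P = mat (n + s) (n + s) (\<lambda>(i, j). if j < Suc n then J $$ (j, i) else if i = j then 1 else 0)"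
  \<comment> \<open>For a clique index \<open>j > n\<close>, \<open>A'\<close> sends the
    \<open>j\<close>-th unit vector to \<open>l\<close> times itself plus \<open>J^T\<close> applied
    to \<open>1 / sqrt s\<close> times the last column of \<open>K\<close>, whatever
    \<open>j\<close> is.\<close>
  define Z where "Z = mat (Suc n) (s - 1) (\<lambda>(a, j). 1 / sqrt (real s) * K $$ (a, n))"
  define T where "T = four_block_mat N Z (0\<^sub>m (s - 1) (Suc n)) (l \<cdot>\<^sub>m 1\<^sub>m (s - 1))"
  have dim: "Suc n + (s - 1) = n + s" using \<open>s > 0\<close> by simp
  have J: "J \<in> carrier_mat (Suc n) (n + s)" "transpose_mat J \<in> carrier_mat (n + s) (Suc n)" by (auto simp: J_def)
  have K: "K \<in> carrier_mat (Suc n) (Suc n)" using N by (simp add: K_def)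
  have A': "A' \<in> carrier_mat (n + s) (n + s)" by (simp add: A'_def blowup_carrier)
  have P: "P \<in> carrier_mat (n + s) (n + s)" by (simp add: P_def)
  have Z: "Z \<in> carrier_mat (Suc n) (s - 1)" by (simp add: Z_def)
  have T: "T \<in> carrier_mat (n + s) (n + s)"
    using four_block_carrier_mat[of N "Suc n" "Suc n" "l \<cdot>\<^sub>m 1\<^sub>m (s - 1)" "s - 1" "s - 1"] N
    unfolding T_def dim by simp
  have T_index: "T $$ (k, j) = (if k < Suc n then if j < Suc n then N $$ (k, j) else 1 / sqrt (real s) * K $$ (k, n)
      else if k = j then l else 0)" if "k < n + s" "j < n + s" for k j
    using that N \<open>s > 0\<close> unfolding T_def by (auto simp: Z_def)
  have det: "det P \<noteq> 0"
  proof -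
    have "det P = prod_list (diag_mat P)"
      by (rule det_lower_triangular[OF _ P]) (auto simp: P_def J_def spread_mat_def)
    also have "\<dots> \<noteq> 0"
      using \<open>s > 0\<close> by (auto simp: prod_list_zero_iff diag_mat_def P_def J_def spread_mat_def spread_weight_def split: if_splits)
    finally show ?thesis .
  qed
  have AP: "A' * P = P * T"
  proof (rule eq_matI)
    fix i j assume "i < dim_row (P * T)" "j < dim_col (P * T)"
    then have ij: "i < n + s" "j < n + s" using P T by auto
    have "(P * T) $$ (i, j) = (\<Sum>k<n + s. P $$ (i, k) * T $$ (k, j))"
      by (rule index_mult_sum[OF P T ij])
    also have "\<dots> = (\<Sum>k<Suc n. P $$ (i, k) * T $$ (k, j)) + (\<Sum>k\<in>{Suc n..<n + s}. P $$ (i, k) * T $$ (k, j))"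
      using \<open>s > 0\<close> by (simp add: lessThan_atLeast0 sum.atLeastLessThan_concat del: sum.op_ivl_Suc)
    also have "(\<Sum>k<Suc n. P $$ (i, k) * T $$ (k, j)) = (\<Sum>k<Suc n. J $$ (k, i) * T $$ (k, j))"
      using ij \<open>s > 0\<close> by (intro sum.cong) (auto simp: P_def)
    also have "\<dots> = spread_weight n s i * T $$ (min i n, j)"
      unfolding J_def by (rule sum_spread_rows[OF ij(1)])
    also have "(\<Sum>k\<in>{Suc n..<n + s}. P $$ (i, k) * T $$ (k, j)) =
      (\<Sum>k\<in>{Suc n..<n + s}. if k = i then T $$ (i, j) else 0)"
      using ij by (intro sum.cong) (auto simp: P_def)
    also have "\<dots> = (if Suc n \<le> i then T $$ (i, j) else 0)"
      using ij by simp
    finally have PT: "(P * T) $$ (i, j) =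
      spread_weight n s i * T $$ (min i n, j) + (if Suc n \<le> i then T $$ (i, j) else 0)" .
    have AP: "(A' * P) $$ (i, j) = (\<Sum>k<n + s. A' $$ (i, k) * P $$ (k, j))"
      by (rule index_mult_sum[OF A' P ij])
    show "(A' * P) $$ (i, j) = (P * T) $$ (i, j)"
    proof (cases "j < Suc n")
      case True
      have "(A' * P) $$ (i, j) = (\<Sum>k<n + s. A' $$ (i, k) * transpose_mat J $$ (k, j))"
        unfolding AP using J True ij \<open>s > 0\<close> by (intro sum.cong) (auto simp: P_def)
      also have "\<dots> = (A' * transpose_mat J) $$ (i, j)"
        by (rule index_mult_sum[OF A' J(2) ij(1) True, symmetric])
      also have "\<dots> = (transpose_mat J * N) $$ (i, j)"
        unfolding A'_def J_def blowup_mult_spread[OF assms] ..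
      also have "\<dots> = (\<Sum>k<Suc n. J $$ (k, i) * N $$ (k, j))"
        unfolding index_mult_sum[OF J(2) N ij(1) True] using J ij by (intro sum.cong) auto
      also have "\<dots> = spread_weight n s i * N $$ (min i n, j)"
        unfolding J_def by (rule sum_spread_rows[OF ij(1)])
      also have "\<dots> = (P * T) $$ (i, j)"
        unfolding PT using ij True by (simp add: T_index)
      finally show ?thesis .
    next
      case False
      have "(A' * P) $$ (i, j) = (\<Sum>k<n + s. if k = j then A' $$ (i, j) else 0)"
        unfolding AP using ij False by (intro sum.cong) (auto simp: P_def)
      also have "\<dots> = A' $$ (i, j)" using ij by simp
      also have "\<dots> = (P * T) $$ (i, j)"
        unfolding PT A'_def index_blowup[OF N ij] using ij False
        by (auto simp: T_index K_def[symmetric] spread_weight_def)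
      finally show ?thesis .
    qed
  qed (use A' P T in auto)
  obtain Q where Q: "Q \<in> carrier_mat (n + s) (n + s)" "Q * P = 1\<^sub>m (n + s)" "P * Q = 1\<^sub>m (n + s)"
    using det_non_zero_imp_unit[OF P det, of "()"] by (auto simp: Units_def ring_mat_def)
  have "A' = A' * (P * Q)" using A' Q(3) by simp
  also have "\<dots> = P * T * Q"
    using A' P Q(1) by (simp add: assoc_mult_mat[symmetric, of _ "n + s" "n + s" _ "n + s" _ "n + s"] AP)
  finally have "similar_mat A' T"
    unfolding similar_mat_def
    by (intro exI[of _ P] exI[of _ Q] similar_mat_witI[of _ _ "n + s"]) (use A' P Q T in auto)
  then have "char_poly A' = char_poly T" by (rule char_poly_similar)
  also have "\<dots> = char_poly N * [:- l, 1:] ^ (s - 1)"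
    unfolding T_def using N Z
    by (subst char_poly_four_block_lower_left_zero[of _ "Suc n" _ "s - 1"]) (auto simp: char_poly_scalar)
  finally show ?thesis by (simp add: A'_def)
qed

text \<open>A test matrix \<open>X\<close> vanishes on the clique block because the clique vertices
  are adjacent. \<open>J X J^T = 0\<close> then clears the old block, and each remaining column lies
  in the kernel of the leading block of \<open>N - l I\<close>.\<close>

lemma SSP_blowup:
  assumes N: "N \<in> carrier_mat (Suc n) (Suc n)" "transpose_mat N = N" and ssp: "SSP N" and "s > 0"
    and pend: "\<And>i. i < n \<Longrightarrow> N $$ (i, n) \<noteq> 0 \<longleftrightarrow> i = u" and Nn: "N $$ (n, n) \<noteq> l"
    and det: "det (char_matrix (mat n n (($$) N)) l) \<noteq> 0"
  shows "SSP (blowup n s l N)"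
proof -
  define J K A' where "J = spread_mat n s" and "K = char_matrix N l" and "A' = blowup n s l N"
  define w where "w = 1 / sqrt (real s)"
  have w: "w > 0" using \<open>s > 0\<close> by (simp add: w_def)
  have J: "J \<in> carrier_mat (Suc n) (n + s)" "transpose_mat J \<in> carrier_mat (n + s) (Suc n)" by (auto simp: J_def)
  have K: "K \<in> carrier_mat (Suc n) (Suc n)" using N by (simp add: K_def)
  have A': "A' \<in> carrier_mat (n + s) (n + s)" by (simp add: A'_def blowup_carrier)
  have JJ: "J * transpose_mat J = 1\<^sub>m (Suc n)" using spread_mat_orthonormal[OF \<open>s > 0\<close>] by (simp add: J_def)
  have A'_index: "A' $$ (i, j) = (if i = j then l else 0) +
    spread_weight n s i * spread_weight n s j * K $$ (min i n, min j n)" if "i < n + s" "j < n + s" for i j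
    unfolding A'_def K_def by (rule index_blowup[OF N(1) that])
  have K_index: "K $$ (i, j) = N $$ (i, j) - (if i = j then l else 0)" if "i < Suc n" "j < Suc n" for i j
    unfolding K_def by (rule index_char_matrix[OF N(1) that])
  have "X = 0\<^sub>m (n + s) (n + s)"
    if X: "supported (n + s) (nonadj A') X" and comm: "commutator A' X = 0\<^sub>m (n + s) (n + s)" for X
  proof -
    have carr: "X \<in> carrier_mat (n + s) (n + s)" and sym: "transpose_mat X = X"
      and zero: "\<And>i j. i < n + s \<Longrightarrow> j < n + s \<Longrightarrow> \<not> nonadj A' i j \<Longrightarrow> X $$ (i, j) = 0"
      using X by (auto simp: supported_def)
    \<comment> \<open>Off the diagonal these entries of \<open>A'\<close> equal
      \<open>w * w * (N $$ (n, n) - l)\<close>, hence are nonzero.\<close>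
    have clique: "X $$ (i, j) = 0" if "i < n + s" "j < n + s" "n \<le> i" "n \<le> j" for i j
      using that w Nn by (intro zero) (auto simp: nonadj_def A'_index K_index spread_weight_def w_def[symmetric])
    have uX: "X $$ (u, j) = 0" if "j < n + s" "n \<le> j" "u < n" for j
      using that w pend[of u] by (intro zero) (auto simp: nonadj_def A'_index K_index spread_weight_def w_def[symmetric])
    define JX where "JX = J * X"
    have JX: "JX \<in> carrier_mat (Suc n) (n + s)" using J(1) carr by (simp add: JX_def)
    have JX_index: "JX $$ (a, j) = (if a < n then X $$ (a, j) else w * (\<Sum>i\<in>{n..<n + s}. X $$ (i, j)))"
      if "a < Suc n" "j < n + s" for a j
      unfolding JX_def index_mult_sum[OF J(1) carr that] unfolding J_def w_def
      by (rule sum_spread_cols[OF that(1)])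
    define H where "H = JX * transpose_mat J"
    have H: "H \<in> carrier_mat (Suc n) (Suc n)" using JX J(2) by (simp add: H_def)
    have H_index: "H $$ (a, b) = (if b < n then JX $$ (a, b) else w * (\<Sum>j\<in>{n..<n + s}. JX $$ (a, j)))"
      if "a < Suc n" "b < Suc n" for a b
    proof -
      have "H $$ (a, b) = (\<Sum>j<n + s. J $$ (b, j) * JX $$ (a, j))"
        unfolding H_def index_mult_sum[OF JX J(2) that] using J(1) that by (intro sum.cong) auto
      then show ?thesis unfolding J_def w_def by (simp only: sum_spread_cols[OF that(2)])
    qed
    \<comment> \<open>Makes the corner of \<open>H\<close> zero, and later removes the last term
      when \<open>K * JX = 0\<close> is read in a clique column.\<close>
    have JX_right: "JX $$ (n, j) = 0" if "j < n + s" "n \<le> j" for j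
      using that clique by (simp add: JX_index)
    have X_sym: "X $$ (i, j) = X $$ (j, i)" if "i < n + s" "j < n + s" for i j
      using sym_entry[OF sym carr that(2,1)] .
    have H_n: "H $$ (a, n) = w * (\<Sum>j\<in>{n..<n + s}. X $$ (a, j))" "H $$ (n, a) = H $$ (a, n)" if "a < n" for a
    proof -
      show n: "H $$ (a, n) = w * (\<Sum>j\<in>{n..<n + s}. X $$ (a, j))"
        using that by (simp add: H_index JX_index)
      have "(\<Sum>j\<in>{n..<n + s}. X $$ (j, a)) = (\<Sum>j\<in>{n..<n + s}. X $$ (a, j))"
        using that X_sym by (intro sum.cong) auto
      then show "H $$ (n, a) = H $$ (a, n)"
        unfolding n using that by (simp add: H_index JX_index)
    qed
    have "supported (Suc n) (nonadj N) H"
      unfolding supported_def sym_iff[OF H]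
    proof (intro conjI allI impI H)
      fix i j assume ij: "i < Suc n" "j < Suc n"
      show "H $$ (i, j) = H $$ (j, i)"
      proof -
        consider "i < n" "j < n" | "i < n" "j = n" | "i = n" "j < n" | "i = n" "j = n"
          using ij by linarith
        then show ?thesis
        proof cases
          case 1
          then show ?thesis using X_sym[of i j] by (simp add: H_index JX_index)
        qed (use H_n(2) in simp_all)
      qed
      assume "\<not> nonadj N i j"
      then consider "i < n" "j < n" "i = j \<or> N $$ (i, j) \<noteq> 0" | "i = u" "u < n" "j = n"
        | "j = u" "u < n" "i = n" | "i = n" "j = n"
        using ij pend[of i] pend[of j] sym_entry[OF N(2,1) ij] by (auto simp: nonadj_def less_Suc_eq)
      then show "H $$ (i, j) = 0"
      proof cases
        case 1
        then have "\<not> nonadj A' i j"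
          by (auto simp: nonadj_def A'_index K_index spread_weight_def)
        then show ?thesis using 1 zero[of i j] by (simp add: H_index JX_index)
      next
        case 2
        then show ?thesis using uX by (simp add: H_n)
      next
        case 3
        then show ?thesis using uX by (simp add: H_n)
      next
        case 4
        then show ?thesis using JX_right by (simp add: H_index)
      qed
    qed
    \<comment> \<open>In \<open>A' X = X A'\<close> the terms \<open>l X\<close> cancel, leaving
      \<open>J^T K J X = X J^T K J\<close>. Multiplication by \<open>J\<close> from the left gives
      the first equation, then by \<open>J^T\<close> from the right the second.\<close>
    moreover have KJX: "K * JX = H * K * J" "K * H = H * K"
    proof -
      have JK: "transpose_mat J * K \<in> carrier_mat (n + s) (Suc n)" using J(2) K by (rule mult_carrier_mat)
      have XJ: "X * transpose_mat J \<in> carrier_mat (n + s) (Suc n)" using carr J(2) by (rule mult_carrier_mat)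
      have XJK: "X * transpose_mat J * K \<in> carrier_mat (n + s) (Suc n)" using XJ K by (rule mult_carrier_mat)
      have HK: "H * K \<in> carrier_mat (Suc n) (Suc n)" using H K by (rule mult_carrier_mat)
      have lI: "l \<cdot>\<^sub>m 1\<^sub>m (n + s) \<in> carrier_mat (n + s) (n + s)" by simp
      have JKJ: "transpose_mat J * K * J \<in> carrier_mat (n + s) (n + s)" using JK J(1) by (rule mult_carrier_mat)
      have "A' = l \<cdot>\<^sub>m 1\<^sub>m (n + s) + transpose_mat J * K * J" by (simp add: A'_def blowup_def J_def K_def)
      then have "A' * X = l \<cdot>\<^sub>m X + transpose_mat J * K * JX" "X * A' = l \<cdot>\<^sub>m X + X * transpose_mat J * K * J"
        using carr
        by (simp_all add: add_mult_distrib_mat[OF lI JKJ carr] mult_add_distrib_mat[OF carr lI JKJ]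
            mult_smult_assoc_mat[OF one_carrier_mat carr] mult_smult_distrib[OF carr one_carrier_mat]
            assoc_mult_mat[OF JK J(1) carr] JX_def[symmetric] assoc_mult_mat[OF carr JK J(1), symmetric]
            assoc_mult_mat[OF carr J(2) K, symmetric])
      moreover have "transpose_mat J * K * JX = X * transpose_mat J * K * J"
      proof (rule eq_matI)
        fix i j assume "i < dim_row (X * transpose_mat J * K * J)" "j < dim_col (X * transpose_mat J * K * J)"
        then have ij: "i < n + s" "j < n + s" using carr J by auto
        have "(A' * X) $$ (i, j) = (X * A') $$ (i, j)"
          using arg_cong[OF comm, of "\<lambda>Y. Y $$ (i, j)"] ij A' carr
          by (simp add: commutator_def del: index_mult_mat(1))
        then show "(transpose_mat J * K * JX) $$ (i, j) = (X * transpose_mat J * K * J) $$ (i, j)"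
          using calculation ij carr J JX by (simp del: index_mult_mat(1))
      qed (use J JX carr in auto)
      then have "J * (transpose_mat J * K * JX) = J * (X * transpose_mat J * K * J)" by simp
      moreover have "J * (transpose_mat J * K * JX) = K * JX"
        using K by (simp add: assoc_mult_mat[OF J(1) JK JX, symmetric] assoc_mult_mat[OF J K, symmetric] JJ)
      moreover have "J * (X * transpose_mat J * K * J) = H * K * J"
        by (simp add: assoc_mult_mat[OF J(1) XJK J(1), symmetric] assoc_mult_mat[OF J(1) XJ K, symmetric]
            assoc_mult_mat[OF J(1) carr J(2), symmetric] JX_def[symmetric] H_def[symmetric])
      ultimately show eq: "K * JX = H * K * J" by simp
      have "K * H = K * JX * transpose_mat J"
        unfolding H_def by (rule assoc_mult_mat[OF K JX J(2), symmetric])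
      also have "\<dots> = H * K"
        unfolding eq assoc_mult_mat[OF HK J] JJ by (rule right_mult_one_mat[OF HK])
      finally show "K * H = H * K" .
    qed
    have "commutator N H = 0\<^sub>m (Suc n) (Suc n)"
    proof -
      have lI: "(- l) \<cdot>\<^sub>m 1\<^sub>m (Suc n) \<in> carrier_mat (Suc n) (Suc n)" by simp
      have "K = N + (- l) \<cdot>\<^sub>m 1\<^sub>m (Suc n)" using N(1) by (simp add: K_def char_matrix_def)
      then have "K * H = N * H + (- l) \<cdot>\<^sub>m H" "H * K = H * N + (- l) \<cdot>\<^sub>m H"
        using H by (simp_all only: add_mult_distrib_mat[OF N(1) lI H] mult_add_distrib_mat[OF H N(1) lI]
            mult_smult_assoc_mat[OF one_carrier_mat H] mult_smult_distrib[OF H one_carrier_mat]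
            left_mult_one_mat right_mult_one_mat)
      then have eq: "N * H + (- l) \<cdot>\<^sub>m H = H * N + (- l) \<cdot>\<^sub>m H" using KJX(2) by simp
      have "(N * H) $$ (i, j) = (H * N) $$ (i, j)" if "i < Suc n" "j < Suc n" for i j
        using arg_cong[OF eq, of "\<lambda>Y. Y $$ (i, j)"] that N(1) H by (simp del: index_mult_mat(1))
      then show ?thesis
        unfolding commutator_def using N(1) H by (intro eq_matI) (auto simp del: index_mult_mat(1))
    qed
    ultimately have H0: "H = 0\<^sub>m (Suc n) (Suc n)"
      using ssp SSP_iff_commutator[OF N(1)] by blast
    have KJX0: "K * JX = 0\<^sub>m (Suc n) (n + s)"
      using K J(1) by (simp add: KJX(1) H0)
    have X1: "X $$ (i, j) = 0" if "i < n" "j < n" for i j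
      using H_index[of i j] JX_index[of i j] that H0 by simp
    \<comment> \<open>Row \<open>n\<close> of \<open>JX\<close> vanishes in column \<open>j\<close>,
      so \<open>K * JX = 0\<close> says that the first \<open>n\<close> entries of that column of
      \<open>X\<close> satisfy the eigenvector equation for \<open>l\<close>.\<close>
    have X2: "X $$ (i, j) = 0" if "i < n" "j < n + s" "n \<le> j" for i j
    proof (rule eigenvector_eq_0[OF _ det _ that(1)])
      fix i assume i: "i < n"
      have "0 = (K * JX) $$ (i, j)" using KJX0 i that by simp
      also have "\<dots> = (\<Sum>a<n. K $$ (i, a) * X $$ (a, j))"
        using i that JX_right[of j] by (simp add: index_mult_sum[OF K JX] JX_index)
      also have "\<dots> = (\<Sum>a<n. mat n n (($$) N) $$ (i, a) * X $$ (a, j)) - (\<Sum>a<n. if a = i then l * X $$ (i, j) else 0)"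
        unfolding sum_subtractf[symmetric] using i by (intro sum.cong) (auto simp: K_index algebra_simps)
      finally show "(\<Sum>a<n. mat n n (($$) N) $$ (i, a) * X $$ (a, j)) = l * X $$ (i, j)"
        using i by simp
    qed simp
    have "X $$ (i, j) = 0" if "i < n + s" "j < n + s" for i j
      using that X1[of i j] X2[of i j] X2[of j i] X_sym[of i j] clique[of i j] by (cases "i < n"; cases "j < n") auto
    then show ?thesis using carr by (intro eq_matI) auto
  qed
  then show ?thesis
    using SSP_iff_commutator[OF A'] by (simp add: A'_def)
qed

section \<open>Pattern, spectrum and distance of the blown-up pendant extension\<close>

theorem theorem3p6:
  fixes n s v :: nat and E :: "nat set set" and A :: "real mat" and l :: real
  assumes "graph_on n E"
    and "A \<in> S_graph n E"
    and "SSP A"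
    and "v \<in> {1..n}"
    and "l \<notin># spec A" and "l \<notin># spec (del_vertex A v)"
    and "s > 0"
  shows "\<forall>\<epsilon>>0. \<exists>A'. A' \<in> S_graph (n + s) (clique_sum n E v s) \<and> SSP A'
           \<and> spec A' = spec A + replicate_mset s l
           \<and> (\<forall>i<n+s. \<forall>j<n+s. \<bar>A' $$ (i,j) - direct_sum_scalar A l s $$ (i,j)\<bar> < \<epsilon>)
           \<and> (\<forall>i\<in>{n+1..n+s}. A' $$ (i-1, i-1) \<noteq> l)"
proof (intro allI impI)
  fix \<epsilon> :: real assume "\<epsilon> > 0"
  have A: "A \<in> carrier_mat n n" "transpose_mat A = A"
    and edges: "\<And>i j. i \<in> {1..n} \<Longrightarrow> j \<in> {1..n} \<Longrightarrow> i \<noteq> j \<Longrightarrow> A $$ (i - 1, j - 1) \<noteq> 0 \<longleftrightarrow> {i, j} \<in> E"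
    using assms(2) by (auto simp: S_graph_def)
  \<comment> \<open>Vertices count from 1 and matrix indices from 0: vertex \<open>v\<close> has
    index \<open>v - 1\<close>, and the pendant vertex \<open>n + 1\<close> has index
    \<open>n\<close>.\<close>
  have u: "v - 1 < n" using assms(4) by auto
  obtain N where N: "N \<in> carrier_mat (Suc n) (Suc n)" "transpose_mat N = N" and "SSP N"
    and char: "char_poly N = char_poly A * [:- l, 1:]"
    and near: "\<And>i j. i < Suc n \<Longrightarrow> j < Suc n \<Longrightarrow> \<bar>N $$ (i, j) - direct_sum_scalar A l 1 $$ (i, j)\<bar> < \<epsilon>"
    and adj: "\<And>i j. i < n \<Longrightarrow> j < n \<Longrightarrow> i \<noteq> j \<Longrightarrow> N $$ (i, j) \<noteq> 0 \<longleftrightarrow> A $$ (i, j) \<noteq> 0"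
    and pend: "\<And>i. i < n \<Longrightarrow> N $$ (i, n) \<noteq> 0 \<longleftrightarrow> i = v - 1"
    and Nn: "N $$ (n, n) \<noteq> l"
    and det: "det (char_matrix (mat n n (($$) N)) l) \<noteq> 0"
    using pendant_extension[OF A assms(3) u assms(5) assms(6)[unfolded del_vertex_def] \<open>\<epsilon> > 0\<close>] by blast
  define A' where "A' = blowup n s l N"
  define w where "w = 1 / sqrt (real s)"
  have w: "0 < w" "w \<le> 1" using \<open>s > 0\<close> by (auto simp: w_def)
  have A': "A' \<in> carrier_mat (n + s) (n + s)" by (simp add: A'_def blowup_carrier)
  have A'_index: "A' $$ (i, j) =
    (if i < n \<and> j < n then N $$ (i, j) else if i < n then w * N $$ (i, n) else if j < n then w * N $$ (n, j)
     else (if i = j then l else 0) + w * w * (N $$ (n, n) - l))" if "i < n + s" "j < n + s" for i j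
    using that by (auto simp: A'_def index_blowup[OF N(1)] index_char_matrix[OF N(1)] spread_weight_def w_def)
  have sym: "transpose_mat A' = A'"
    unfolding sym_iff[OF A'] using sym_entry[OF N(2,1)] by (auto simp: A'_index)
  have pattern: "A' $$ (i - 1, j - 1) \<noteq> 0 \<longleftrightarrow> {i, j} \<in> clique_sum n E v s"
    if ij: "i \<in> {1..n + s}" "j \<in> {1..n + s}" "i < j" for i j
  proof -
    have "(\<exists>a b. {i, j} = {a, b} \<and> a \<noteq> b \<and> a \<in> S \<and> b \<in> S) \<longleftrightarrow> i \<in> S \<and> j \<in> S" for S
      using ij by (auto simp: doubleton_eq_iff)
    then have clique: "{i, j} \<in> clique_sum n E v s \<longleftrightarrow>
      {i, j} \<in> E \<or> i \<in> insert v {n+1..n+s} \<and> j \<in> insert v {n+1..n+s}"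
      unfolding clique_sum_def by (simp only: Un_iff mem_Collect_eq)
    have E: "i \<le> n \<and> j \<le> n" if "{i, j} \<in> E"
      using that assms(1) by (force simp: graph_on_def doubleton_eq_iff)
    \<comment> \<open>Two old vertices, one old and one new, two new. In the first case the clique
      adds no edge, since \<open>v\<close> alone is both old and in the clique.\<close>
    consider "j \<le> n" | "i \<le> n" "n < j" | "n < i" using ij by linarith
    then show ?thesis
    proof cases
      case 1
      then show ?thesis
        unfolding clique using ij edges[of i j] adj[of "i - 1" "j - 1"] assms(4) by (auto simp: A'_index)
    next
      case 2
      then show ?thesis
        unfolding clique using ij E pend[of "i - 1"] assms(4) w by (auto simp: A'_index)
    next
      case 3
      then show ?thesis
        unfolding clique using ij Nn w by (auto simp: A'_index)
    qed
  qed
  have "A' \<in> S_graph (n + s) (clique_sum n E v s)"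
    unfolding S_graph_def mem_Collect_eq
  proof (intro conjI A' sym ballI impI)
    fix i j assume ij: "i \<in> {1..n + s}" "j \<in> {1..n + s}" "i \<noteq> j"
    have "A' $$ (i - 1, j - 1) = A' $$ (j - 1, i - 1)"
      using ij by (intro sym_entry[OF sym A']) auto
    then show "A' $$ (i - 1, j - 1) \<noteq> 0 \<longleftrightarrow> {i, j} \<in> clique_sum n E v s"
      using pattern[of i j] pattern[of j i] ij by (cases "i < j") (auto simp: insert_commute)
  qed
  moreover have "SSP A'"
    unfolding A'_def by (rule SSP_blowup[OF N \<open>SSP N\<close> \<open>s > 0\<close> pend Nn det])
  moreover have "spec A' = spec A + replicate_mset s l"
  proof -
    \<comment> \<open>One factor comes from the pendant vertex, the other \<open>s - 1\<close> from
      the blow-up.\<close>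
    have "char_poly A' = char_poly A * [:- l, 1:] ^ s"
      using char_poly_blowup[OF N(1) \<open>s > 0\<close>, of l] \<open>s > 0\<close>
      unfolding A'_def char by (simp only: mult.assoc power_Suc[symmetric] Suc_diff_1)
    then show ?thesis
      unfolding spec_def using char_poly_nonzero[OF A(1)]
      by (simp add: proots_mult proots_power)
  qed
  moreover have "\<bar>A' $$ (i, j) - direct_sum_scalar A l s $$ (i, j)\<bar> < \<epsilon>" if "i < n + s" "j < n + s" for i j
  proof -
    \<comment> \<open>The scalar \<open>l I\<close> is common to both sides, so spreading multiplies
      the deviation of \<open>N\<close> by weights at most 1 and the same \<epsilon>
      suffices.\<close>
    have "A' $$ (i, j) - direct_sum_scalar A l s $$ (i, j) =
      spread_weight n s i * spread_weight n s j *
        (N $$ (min i n, min j n) - direct_sum_scalar A l 1 $$ (min i n, min j n))"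
      using that A(1)
      by (auto simp: A'_index direct_sum_scalar_1_index[OF A(1)] direct_sum_scalar_def spread_weight_def w_def)
    then have "\<bar>A' $$ (i, j) - direct_sum_scalar A l s $$ (i, j)\<bar> =
      \<bar>spread_weight n s i * spread_weight n s j\<bar> *
        \<bar>N $$ (min i n, min j n) - direct_sum_scalar A l 1 $$ (min i n, min j n)\<bar>"
      by (simp only: abs_mult)
    also have "\<dots> \<le> 1 * \<bar>N $$ (min i n, min j n) - direct_sum_scalar A l 1 $$ (min i n, min j n)\<bar>"
      using w by (intro mult_right_mono) (auto simp: spread_weight_def w_def[symmetric] abs_mult mult_le_one)
    also have "\<dots> < \<epsilon>" using near[of "min i n" "min j n"] by simp
    finally show ?thesis .
  qed
  moreover have "\<forall>i\<in>{n+1..n+s}. A' $$ (i-1, i-1) \<noteq> l"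
  proof
    fix i assume "i \<in> {n+1..n+s}"
    then have "A' $$ (i - 1, i - 1) = l + w * w * (N $$ (n, n) - l)"
      by (subst A'_index) auto
    then show "A' $$ (i - 1, i - 1) \<noteq> l" using Nn w by simp
  qed
  ultimately show "\<exists>A'. A' \<in> S_graph (n + s) (clique_sum n E v s) \<and> SSP A'
           \<and> spec A' = spec A + replicate_mset s l
           \<and> (\<forall>i<n+s. \<forall>j<n+s. \<bar>A' $$ (i,j) - direct_sum_scalar A l s $$ (i,j)\<bar> < \<epsilon>)
           \<and> (\<forall>i\<in>{n+1..n+s}. A' $$ (i-1, i-1) \<noteq> l)"
    by blast
qed

end
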